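(* The following groups, where $p$ is an arbitrary prime number, are, up to conjugation in $G=\mathrm{SU}(2)^3$ and permutation of the three factors of $G$, the only non-trivial finite simple subgroups $C\subset G$ acting freely on $M=G/\Delta(\mathrm{SU}(2))$ (that is, all of them act freely, and every non-trivial finite simple subgroup acting freely is one of them up to conjugation and permutation of the factors): (a) $\mathbb{Z}_p\times\{1\}\times\{1\}$; (b) $\Gamma(\varphi(r))\times\{1\}$, where $\varphi(r)\in\mathrm{Aut}(\mathbb{Z}_p)$; (c) $C(p,r,s)=\{(x,\varphi(r)(x),\varphi(s)(x)) : x\in\mathbb{Z}_p\}$, where $\varphi(r),\varphi(s)$ are automorphisms of $\mathbb{Z}_p$ and either $r\not\equiv\pm1 \bmod p$ or $s\not\equiv\pm1\bmod p$.
   Context: $\mathrm{SU}(2)$ is identified with the unit quaternions. $G=\mathrm{SU}(2)\times\mathrm{SU}(2)\times\mathrm{SU}(2)$, $K=\Delta(\mathrm{SU}(2))=\{(w,w,w)\}\subset G$, and $M=G/K\cong S^3\times S^3$; subgroups of $G$ act on $M$ by left translation, and a subgroup acts freely if none of its non-trivial elements fixes a point of $M$. $\mathbb{Z}_p=\{e^{2\pi i x/p}: x=0,\dots,p-1\}\subset\mathrm{SU}(2)$. For an integer $r$ with $\gcd(r,p)=1$, $\varphi(r)$ is the automorphism $x\mapsto x^r$ of $\mathbb{Z}_p$, and $\Gamma(\varphi(r))=\{(x,\varphi(r)(x)):x\in\mathbb{Z}_p\}\subset\mathrm{SU}(2)^2$ is its graph. The condition $r\not\equiv\pm1$ means that $r$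 is congruent neither to $1$ nor to $-1$. *)

theory Defs
  imports
    "HOL-Analysis.Analysis"
    "HOL-Algebra.Left_Coset"
    "HOL-Algebra.SimpleGroups"
    "HOL-Combinatorics.Permutations"
    "HOL-Number_Theory.Cong"
begin

type_synonym cmat2 = "complex ^ 2 ^ 2"

definition conj_transpose :: "cmat2 \<Rightarrow> cmat2" where
  "conj_transpose A = (\<chi> i j. cnj (A $ j $ i))"

definition SU2 :: "cmat2 monoid" where
  "SU2 = \<lparr>carrier = {A. conj_transpose A ** A = mat 1 \<and> det A = 1},
          mult = (**), one = mat 1\<rparr>"

text \<open>The matrix of the quaternion \<open>a + b j\<close>, where \<open>a\<close> and \<open>b\<close> are complex numbers
  and \<open>j z = cnj z j\<close>.  Thus the unit quaternions are identified with \<open>SU2\<close>, and a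
  complex number \<open>z\<close> of modulus one becomes the diagonal matrix with entries \<open>z\<close> and
  \<open>cnj z\<close>.\<close>

definition quat :: "complex \<Rightarrow> complex \<Rightarrow> cmat2" where
  "quat a b = vector [vector [a, b], vector [- cnj b, cnj a]]"

lemma quat_nth [simp]:
  "quat a b $ 1 $ 1 = a" "quat a b $ 1 $ 2 = b"
  "quat a b $ 2 $ 1 = - cnj b" "quat a b $ 2 $ 2 = cnj a"
  by (simp_all add: quat_def)

lemma quat_mult: "quat a b ** quat c d = quat (a * c - b * cnj d) (a * d + b * cnj c)"
  by (simp add: vec_eq_iff forall_2 matrix_matrix_mult_def sum_2)

lemma quat_one: "quat 1 0 = mat 1"
  by (simp add: vec_eq_iff forall_2 mat_def)

lemma conj_transpose_quat: "conj_transpose (quat a b) = quat (cnj a) (- b)"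
  by (simp add: vec_eq_iff forall_2 conj_transpose_def)

lemma quat_eq_iff: "quat a b = quat c d \<longleftrightarrow> a = c \<and> b = d"
  by (auto simp: vec_eq_iff forall_2)

lemma det_quat: "det (quat a b) = a * cnj a + b * cnj b"
  by (simp add: det_2)

lemma carrier_SU2_eq: "carrier SU2 = {quat a b | a b. (cmod a)\<^sup>2 + (cmod b)\<^sup>2 = 1}"
proof (intro equalityI subsetI)
  fix A assume "A \<in> carrier SU2"
  then have un: "conj_transpose A ** A = mat 1" and dt: "det A = 1"
    by (simp_all add: SU2_def)
  define B :: cmat2 where
    "B = vector [vector [A $ 2 $ 2, - A $ 1 $ 2], vector [- A $ 2 $ 1, A $ 1 $ 1]]"
  have "A ** B = mat 1"
    using dt by (simp add: B_def vec_eq_iff forall_2 matrix_matrix_mult_def sum_2 det_2 mat_def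
        algebra_simps)
  then have "conj_transpose A = B"
    using un by (metis matrix_mul_assoc matrix_mul_lid matrix_mul_rid)
  then have "A = quat (A $ 1 $ 1) (A $ 1 $ 2)"
    by (auto simp: B_def vec_eq_iff forall_2 conj_transpose_def)
  moreover from this have "complex_of_real ((cmod (A $ 1 $ 1))\<^sup>2 + (cmod (A $ 1 $ 2))\<^sup>2) = 1"
    using dt det_quat[of "A $ 1 $ 1" "A $ 1 $ 2"]
    by (metis complex_norm_square of_real_add)
  ultimately show "A \<in> {quat a b | a b. (cmod a)\<^sup>2 + (cmod b)\<^sup>2 = 1}"
    by (metis (mono_tags, lifting) mem_Collect_eq of_real_eq_1_iff)
next
  fix A assume "A \<in> {quat a b | a b. (cmod a)\<^sup>2 + (cmod b)\<^sup>2 = 1}"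
  then obtain a b where A: "A = quat a b" and n: "(cmod a)\<^sup>2 + (cmod b)\<^sup>2 = 1"
    by blast
  have "a * cnj a + b * cnj b = 1"
    using n by (metis complex_norm_square of_real_1 of_real_add)
  then show "A \<in> carrier SU2"
    by (simp add: A SU2_def det_quat conj_transpose_quat quat_mult algebra_simps
        flip: quat_one)
qed

lemma group_SU2: "group SU2"
proof (rule groupI)
  fix A B assume A: "A \<in> carrier SU2" and B: "B \<in> carrier SU2"
  have "conj_transpose (A ** B) = conj_transpose B ** conj_transpose A"
    by (simp add: vec_eq_iff forall_2 conj_transpose_def matrix_matrix_mult_def sum_2
        mult.commute)
  then have "conj_transpose (A ** B) ** (A ** B)
      = conj_transpose B ** (conj_transpose A ** A) ** B"
    by (simp add: matrix_mul_assoc)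
  then show "A \<otimes>\<^bsub>SU2\<^esub> B \<in> carrier SU2"
    using A B by (simp add: SU2_def det_mul)
next
  show "\<one>\<^bsub>SU2\<^esub> \<in> carrier SU2"
    by (simp add: SU2_def conj_transpose_quat quat_mult flip: quat_one)
      (simp add: det_quat)
next
  fix A B C
  show "A \<otimes>\<^bsub>SU2\<^esub> B \<otimes>\<^bsub>SU2\<^esub> C = A \<otimes>\<^bsub>SU2\<^esub> (B \<otimes>\<^bsub>SU2\<^esub> C)"
    by (simp add: SU2_def matrix_mul_assoc)
next
  fix A show "\<one>\<^bsub>SU2\<^esub> \<otimes>\<^bsub>SU2\<^esub> A = A"
    by (simp add: SU2_def)
next
  fix A assume "A \<in> carrier SU2"
  then obtain a b where A: "A = quat a b" and n: "(cmod a)\<^sup>2 + (cmod b)\<^sup>2 = 1"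
    by (auto simp: carrier_SU2_eq)
  have "conj_transpose A \<in> carrier SU2"
    unfolding A conj_transpose_quat carrier_SU2_eq using n by force
  moreover have "conj_transpose A \<otimes>\<^bsub>SU2\<^esub> A = \<one>\<^bsub>SU2\<^esub>"
    using \<open>A \<in> carrier SU2\<close> by (simp add: SU2_def)
  ultimately show "\<exists>B\<in>carrier SU2. B \<otimes>\<^bsub>SU2\<^esub> A = \<one>\<^bsub>SU2\<^esub>"
    by blast
qed

definition G :: "(cmat2 \<times> cmat2 \<times> cmat2) monoid" where
  "G = SU2 \<times>\<times> SU2 \<times>\<times> SU2"

lemma group_G: "group G"
  unfolding G_def by (intro DirProd_group group_SU2)

definition K :: "(cmat2 \<times> cmat2 \<times> cmat2) set" where
  "K = {(w, w, w) | w. w \<in> carrier SU2}"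

lemma subgroup_K: "subgroup K G"
proof -
  interpret S: group SU2 by (rule group_SU2)
  have "inv\<^bsub>G\<^esub> (w, w, w) = (inv\<^bsub>SU2\<^esub> w, inv\<^bsub>SU2\<^esub> w, inv\<^bsub>SU2\<^esub> w)" if "w \<in> carrier SU2" for w
    unfolding G_def using that by (simp add: inv_DirProd DirProd_group group_SU2)
  then show ?thesis
    by (intro group.subgroupI[OF group_G]) (auto simp: K_def G_def)
qed

definition M :: "(cmat2 \<times> cmat2 \<times> cmat2) set set" where
  "M = lcosets\<^bsub>G\<^esub> K"

text \<open>An element \<open>c\<close> of \<open>G\<close> moves the point \<open>m\<close> of \<open>M\<close> to its left translate
  \<open>c <#\<^bsub>G\<^esub> m\<close>.\<close>

definition acts_freely :: "(cmat2 \<times> cmat2 \<times> cmat2) set \<Rightarrow> bool" where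
  "acts_freely C \<longleftrightarrow> (\<forall>c\<in>C. c \<noteq> \<one>\<^bsub>G\<^esub> \<longrightarrow> (\<forall>m\<in>M. c <#\<^bsub>G\<^esub> m \<noteq> m))"

text \<open>\<open>simple_group\<close> already excludes the trivial group and, since \<open>order\<close> is \<open>0\<close> for
  infinite groups, the infinite ones; the first two of these conditions are kept explicit.\<close>

definition nontrivial_finite_simple_subgroup :: "(cmat2 \<times> cmat2 \<times> cmat2) set \<Rightarrow> bool" where
  "nontrivial_finite_simple_subgroup C \<longleftrightarrow>
     subgroup C G \<and> finite C \<and> C \<noteq> {\<one>\<^bsub>G\<^esub>} \<and> simple_group (G\<lparr>carrier := C\<rparr>)"

fun factor :: "'a \<times> 'a \<times> 'a \<Rightarrow> nat \<Rightarrow> 'a" where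
  "factor (x, y, z) i = [x, y, z] ! i"

definition permute_factors :: "(nat \<Rightarrow> nat) \<Rightarrow> 'a \<times> 'a \<times> 'a \<Rightarrow> 'a \<times> 'a \<times> 'a" where
  "permute_factors \<pi> g = (factor g (\<pi> 0), factor g (\<pi> 1), factor g (\<pi> 2))"

text \<open>Permutations of the factors normalise the inner automorphisms of \<open>G\<close>, so one
  permutation followed by one conjugation gives every combination of the two.\<close>

definition equivalent ::
  "(cmat2 \<times> cmat2 \<times> cmat2) set \<Rightarrow> (cmat2 \<times> cmat2 \<times> cmat2) set \<Rightarrow> bool" where
  "equivalent C D \<longleftrightarrow>
     (\<exists>\<pi> g. \<pi> permutes {0, 1, 2} \<and> g \<in> carrier G \<and>
            C = g <#\<^bsub>G\<^esub> (permute_factors \<pi> ` D) #>\<^bsub>G\<^esub> inv\<^bsub>G\<^esub> g)"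

definition Zp :: "nat \<Rightarrow> cmat2 set" where
  "Zp p = {quat (exp (2 * pi * \<i> * x / p)) 0 | x :: nat. x < p}"

definition phi :: "int \<Rightarrow> cmat2 \<Rightarrow> cmat2" where
  "phi r x = x [^]\<^bsub>SU2\<^esub> r"

definition graph_phi :: "nat \<Rightarrow> int \<Rightarrow> (cmat2 \<times> cmat2) set" where
  "graph_phi p r = {(x, phi r x) | x. x \<in> Zp p}"

definition group_a :: "nat \<Rightarrow> (cmat2 \<times> cmat2 \<times> cmat2) set" where
  "group_a p = Zp p \<times> {\<one>\<^bsub>SU2\<^esub>} \<times> {\<one>\<^bsub>SU2\<^esub>}"

definition group_b :: "nat \<Rightarrow> int \<Rightarrow> (cmat2 \<times> cmat2 \<times> cmat2) set" where
  "group_b p r = {(x, y, \<one>\<^bsub>SU2\<^esub>) | x y. (x, y) \<in> graph_phi p r}"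

definition group_c :: "nat \<Rightarrow> int \<Rightarrow> int \<Rightarrow> (cmat2 \<times> cmat2 \<times> cmat2) set" where
  "group_c p r s = {(x, phi r x, phi s x) | x. x \<in> Zp p}"

definition listed_groups :: "(cmat2 \<times> cmat2 \<times> cmat2) set set" where
  "listed_groups =
     {group_a p | p. prime p}
   \<union> {group_b p r | p r. prime p \<and> coprime r (int p)}
   \<union> {group_c p r s | p r s. prime p \<and> coprime r (int p) \<and> coprime s (int p) \<and>
        (\<not> ([r = 1] (mod int p) \<or> [r = - 1] (mod int p)) \<or>
         \<not> ([s = 1] (mod int p) \<or> [s = - 1] (mod int p)))}"

end

theory Submission
  imports Defs "HOL-Algebra.Multiplicative_Group"
begin

text \<open>By simplicity, each coordinate projection of a finite simple subgroup \<open>C\<close> of \<open>SU(2)\<^sup>3\<close> to \<open>SU(2)\<close> is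
  trivial or injective.  The only element of order two in \<open>SU(2)\<close> is the central element \<open>- 1\<close>.  If it is in
  the image of a projection, then \<open>C\<close> has a non-trivial centre and is abelian.  If it is in no image, then
  all images are abelian (\<open>finite_subgroup_SU2_commutes\<close>), and so is \<open>C\<close>.  The
  fact about images is the substantial step; it is an averaging argument based on
  \<open>A\<^sup>2 = tr(A) A - 1\<close>.

  Consequently \<open>C\<close> is cyclic of prime order \<open>p\<close>.  Diagonalising the coordinates of a generator shows that
  \<open>C\<close> is conjugate to the group of all \<open>(\<zeta>\<^bsup>nk\<^esup>, \<zeta>\<^bsup>nl\<^esup>, \<zeta>\<^bsup>nm\<^esup>)\<close> with \<open>\<zeta>\<close> a primitive \<open>p\<close>-th root of unity.
  After a permutation of the factors and a change of generator, the exponents are \<open>(1, r, s)\<close>, with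
  \<open>s = 0\<close> if \<open>r = 0\<close>.

  An element of \<open>SU(2)\<^sup>3\<close> fixes a point of \<open>M\<close> if and only if its coordinates are conjugate in \<open>SU(2)\<close>, that is,
  have the same trace (\<open>fixes_point_iff\<close>).  For the group with exponents \<open>(1, r, s)\<close> this happens for a
  non-trivial element exactly when \<open>r\<close> and \<open>s\<close> are both \<open>\<plusminus>1\<close> modulo \<open>p\<close>.  The groups with exponents
  \<open>(1, r, s)\<close> for which this fails are the listed ones, which settles both directions.\<close>

section \<open>Finite subgroups of SU(2) without \<open>-1\<close>\<close>

lemma SU2_simps [simp]:
  "x \<otimes>\<^bsub>SU2\<^esub> y = x ** y" "\<one>\<^bsub>SU2\<^esub> = mat 1"
  by (simp_all add: SU2_def)

lemma quat_in_SU2: "quat a b \<in> carrier SU2 \<longleftrightarrow> (cmod a)\<^sup>2 + (cmod b)\<^sup>2 = 1"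
  by (auto simp: carrier_SU2_eq quat_eq_iff)

lemma SU2_cases:
  assumes "A \<in> carrier SU2"
  obtains a b where "A = quat a b" "(cmod a)\<^sup>2 + (cmod b)\<^sup>2 = 1"
  using assms by (auto simp: carrier_SU2_eq)

lemma quat_norm_product: "(cmod a)\<^sup>2 + (cmod b)\<^sup>2 = 1 \<Longrightarrow> a * cnj a + b * cnj b = 1"
  by (metis complex_norm_square of_real_1 of_real_add)

lemma inv_SU2:
  assumes "A \<in> carrier SU2" shows "inv\<^bsub>SU2\<^esub> A = conj_transpose A"
proof -
  interpret S: group SU2 by (rule group_SU2)
  obtain a b where A: "A = quat a b" and n: "(cmod a)\<^sup>2 + (cmod b)\<^sup>2 = 1"
    using assms by (rule SU2_cases)
  have "conj_transpose A \<in> carrier SU2"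
    using n by (simp add: A conj_transpose_quat quat_in_SU2)
  moreover have "conj_transpose A \<otimes>\<^bsub>SU2\<^esub> A = \<one>\<^bsub>SU2\<^esub>"
    using assms by (simp add: SU2_def)
  ultimately show ?thesis
    using S.inv_equality assms by blast
qed

text \<open>Cayley--Hamilton for a matrix of determinant \<open>1\<close>: \<open>A\<^sup>2 = tr(A) A - 1\<close>, where the trace of
  \<open>quat a b\<close> is \<open>2 Re a\<close>.\<close>

lemma SU2_square:
  fixes a b :: complex
  assumes "(cmod a)\<^sup>2 + (cmod b)\<^sup>2 = 1"
  shows "quat a b ** quat a b = quat (2 * Re a * a - 1) (2 * Re a * b)"
proof -
  have n: "a * cnj a + b * cnj b = 1"
    using assms by (rule quat_norm_product)
  have r: "complex_of_real (2 * Re a) = a + cnj a"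
    by (simp add: complex_add_cnj)
  have "a * a - b * cnj b = (a + cnj a) * a - (a * cnj a + b * cnj b)"
    by (simp add: algebra_simps)
  moreover have "a * b + b * cnj a = (a + cnj a) * b"
    by (simp add: algebra_simps)
  ultimately show ?thesis
    unfolding quat_mult quat_eq_iff n using r by simp
qed

text \<open>By Cayley--Hamilton, \<open>A\<^sup>2 = B\<^sup>2\<close> means \<open>tr(A) A = tr(B) B\<close>.  If the trace of \<open>A\<close> vanishes, then
  \<open>- 1 = A\<^sup>2\<close> lies in the group; otherwise comparing real parts gives \<open>B = \<plusminus> A\<close>, and \<open>B = - A\<close> puts
  \<open>- 1 = A\<inverse> B\<close> into the group.\<close>

lemma inj_on_square:
  assumes H: "subgroup H SU2" and no: "- mat 1 \<notin> H"
  shows "inj_on (\<lambda>A. A ** A) H"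
proof (rule inj_onI)
  interpret S: group SU2 by (rule group_SU2)
  fix A B assume AB: "A \<in> H" "B \<in> H" and eq: "A ** A = B ** B"
  have car: "A \<in> carrier SU2" "B \<in> carrier SU2"
    using AB H by (auto dest: subgroup.mem_carrier)
  obtain a b where A: "A = quat a b" and n: "(cmod a)\<^sup>2 + (cmod b)\<^sup>2 = 1"
    using car(1) by (rule SU2_cases)
  obtain c d where B: "B = quat c d" and m: "(cmod c)\<^sup>2 + (cmod d)\<^sup>2 = 1"
    using car(2) by (rule SU2_cases)
  have minus: "quat (-1) 0 = - mat 1"
    by (simp add: vec_eq_iff forall_2 mat_def)
  from eq have e: "Re a * a = Re c * c" "Re a * b = Re c * d"
    unfolding A B SU2_square[OF n] SU2_square[OF m] quat_eq_iff by auto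
  have "A ** A \<in> H"
    using AB subgroup.m_closed[OF H, of A A] by simp
  then have "Re a \<noteq> 0"
    using no unfolding A SU2_square[OF n] by (auto simp: minus)
  have "Re a * Re a = Re c * Re c"
    using arg_cong[OF e(1), of Re] by simp
  then consider "Re c = Re a" | "Re c = - Re a"
    by (metis square_eq_iff)
  then show "A = B"
  proof cases
    case 1
    then have "of_real (Re a) * c = of_real (Re a) * a" "of_real (Re a) * d = of_real (Re a) * b"
      using e by metis+
    then have "c = a" "d = b"
      using \<open>Re a \<noteq> 0\<close> by (metis mult_cancel_left of_real_eq_0_iff)+
    then show ?thesis by (simp add: A B)
  next
    case 2
    then have "of_real (Re a) * c = of_real (Re a) * (- a)" "of_real (Re a) * d = of_real (Re a) * (- b)"
      unfolding mult_minus_right using e by (metis of_real_minus mult_minus_left minus_minus)+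
    then have cd: "c = - a" "d = - b"
      using \<open>Re a \<noteq> 0\<close> by (metis mult_cancel_left of_real_eq_0_iff)+
    have "inv\<^bsub>SU2\<^esub> A \<otimes>\<^bsub>SU2\<^esub> B \<in> H"
      using AB H by (meson subgroup.m_closed subgroup.m_inv_closed)
    moreover have "- (a * cnj a) - b * cnj b = - (a * cnj a + b * cnj b)"
      by simp
    then have "inv\<^bsub>SU2\<^esub> A \<otimes>\<^bsub>SU2\<^esub> B = - mat 1"
      unfolding inv_SU2[OF car(1)] minus[symmetric] quat_norm_product[OF n]
      by (simp add: A B conj_transpose_quat quat_mult quat_eq_iff cd mult.commute)
    ultimately show ?thesis
      using no by simp
  qed
qed

lemma quat_sum: "(\<Sum>x\<in>X. quat (f x) (g x)) = quat (\<Sum>x\<in>X. f x) (\<Sum>x\<in>X. g x)"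
  by (simp add: vec_eq_iff forall_2 sum_component cnj_sum sum_negf)

lemma matrix_sum_distrib:
  fixes A :: cmat2
  shows "A ** (\<Sum>x\<in>X. f x) = (\<Sum>x\<in>X. A ** f x)" "(\<Sum>x\<in>X. f x) ** A = (\<Sum>x\<in>X. f x ** A)"
   by (induction X rule: infinite_finite_induct)
     (auto simp: matrix_matrix_mult_def vec_eq_iff sum_2 forall_2 algebra_simps)

text \<open>The centraliser of a non-real quaternion is a plane over the reals, hence commutative.  The
  quaternion here is \<open>q + q' j\<close> with \<open>q\<close> a non-zero multiple of \<open>\<i>\<close>.\<close>

lemma commute_of_commute_quat:
  assumes q: "Im q \<noteq> 0" "Re q = 0"
    and a: "quat q q' ** quat a b = quat a b ** quat q q'"
    and c: "quat q q' ** quat c d = quat c d ** quat q q'"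
  shows "quat a b ** quat c d = quat c d ** quat a b"
proof -
  define k where "k = q' / Im q"
  \<comment> \<open>The quaternions commuting with \<open>q + q' j\<close> are the real combinations of \<open>1\<close> and
    \<open>\<i> + k j\<close>.\<close>
  have off: "y = Im x * k" if "quat q q' ** quat x y = quat x y ** quat q q'" for x y
  proof -
    have "q * y + q' * cnj x = x * q' + y * cnj q"
      using that by (simp add: quat_mult quat_eq_iff)
    then have "y * (q - cnj q) = (x - cnj x) * q'"
      by (simp add: algebra_simps)
    then have "y * (2 * \<i> * Im q) = (2 * \<i> * Im x) * q'"
      by (simp add: complex_diff_cnj mult_ac)
    then show ?thesis
      using q by (simp add: k_def field_simps)
  qed
  have "a * d + b * cnj c = c * b + d * cnj a"
  proof -
    have "(a - cnj a) * d = (c - cnj c) * b"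
      unfolding off[OF a] off[OF c] complex_diff_cnj by (simp add: mult_ac)
    then show ?thesis by (simp add: algebra_simps)
  qed
  moreover have "b * cnj d = d * cnj b"
    unfolding off[OF a] off[OF c] by simp
  ultimately show ?thesis
    by (simp add: quat_mult quat_eq_iff mult.commute)
qed

lemma sum_mult_left_subgroup:
  assumes H: "subgroup H SU2" and "A \<in> H"
  shows "(\<Sum>B\<in>H. f (A ** B)) = (\<Sum>B\<in>H. f B)"
proof -
  interpret S: group SU2 by (rule group_SU2)
  interpret H: subgroup H SU2 by fact
  have car: "\<And>B. B \<in> H \<Longrightarrow> B \<in> carrier SU2" by (rule H.mem_carrier)
  show ?thesis
  proof (rule sum.reindex_bij_witness[where i = "\<lambda>B. inv\<^bsub>SU2\<^esub> A ** B" and j = "\<lambda>B. A ** B"])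
    fix B assume B: "B \<in> H"
    show "inv\<^bsub>SU2\<^esub> A ** (A ** B) = B" "A ** (inv\<^bsub>SU2\<^esub> A ** B) = B"
      using S.l_inv[of A] S.r_inv[of A] car[OF \<open>A \<in> H\<close>] by (simp_all add: matrix_mul_assoc)
    show "A ** B \<in> H" "inv\<^bsub>SU2\<^esub> A ** B \<in> H"
      using H.m_closed[of A B] H.m_closed[of "inv\<^bsub>SU2\<^esub> A" B] \<open>A \<in> H\<close> B by auto
  qed auto
qed

text \<open>The sum \<open>S\<close> of the elements of \<open>H\<close> is a quaternion with \<open>A S = S\<close> for \<open>A \<in> H\<close>; since quaternions
  have no zero divisors, \<open>S = 0\<close> as soon as some \<open>A \<noteq> 1\<close> occurs.\<close>

lemma sum_subgroup_entry_eq_0: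
  assumes H: "subgroup H SU2" and A: "A \<in> H" "A \<noteq> mat 1"
  shows "(\<Sum>B\<in>H. B $ 1 $ 1) = 0"
proof -
  have car: "\<And>B. B \<in> H \<Longrightarrow> B = quat (B $ 1 $ 1) (B $ 1 $ 2)"
    using H by (auto dest!: subgroup.mem_carrier elim!: SU2_cases)
  define s t where "s = (\<Sum>B\<in>H. B $ 1 $ 1)" and "t = (\<Sum>B\<in>H. B $ 1 $ 2)"
  have sum: "(\<Sum>B\<in>H. B) = quat s t"
    unfolding s_def t_def quat_sum[symmetric] using car by (intro sum.cong) auto
  obtain c d where Acd: "A = quat c d" using car[OF A(1)] by blast
  have "A ** quat s t = quat s t"
    using sum_mult_left_subgroup[OF H A(1), of "\<lambda>B. B"] unfolding sum[symmetric] matrix_sum_distrib .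
  then have e: "c * s - d * cnj t = s" "c * t + d * cnj s = t"
    by (simp_all add: Acd quat_mult quat_eq_iff)
  have "cnj (c * t + d * cnj s) = cnj t" using e(2) by simp
  then have e2: "cnj c * cnj t + cnj d * s = cnj t" by simp
  \<comment> \<open>Multiply \<open>(A - 1) S = 0\<close> from the left by the conjugate of \<open>A - 1\<close>.\<close>
  have "((c - 1) * cnj (c - 1) + d * cnj d) * s
      = cnj (c - 1) * (c * s - d * cnj t - s) + d * (cnj c * cnj t + cnj d * s - cnj t)"
    by (simp add: algebra_simps)
  also have "\<dots> = 0" using e(1) e2 by simp
  finally have "complex_of_real ((cmod (c - 1))\<^sup>2 + (cmod d)\<^sup>2) * s = 0"
    by (metis complex_norm_square of_real_add)
  moreover have "c - 1 \<noteq> 0 \<or> d \<noteq> 0"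
    using A(2) by (auto simp: Acd quat_one[symmetric])
  then have "(cmod (c - 1))\<^sup>2 + (cmod d)\<^sup>2 \<noteq> 0"
    by (auto simp: sum_power2_eq_zero_iff)
  then have "complex_of_real ((cmod (c - 1))\<^sup>2 + (cmod d)\<^sup>2) \<noteq> 0"
    by (metis of_real_eq_0_iff)
  ultimately show ?thesis by (auto simp: s_def)
qed

text \<open>A finite subgroup of \<open>SU(2)\<close> without \<open>- 1\<close> is abelian.  Squaring permutes \<open>H\<close>, so the sum of the
  squares is the sum of the elements, which is \<open>0\<close>; read through \<open>A\<^sup>2 = tr(A) A - 1\<close>, this says that
  \<open>2 (Re a)\<^sup>2\<close> has mean value \<open>1\<close> over \<open>H\<close>.  The average of the conjugates of the quaternion \<open>\<i>\<close>
  commutes with \<open>H\<close>.  If its first entry is not \<open>0\<close>, then \<open>H\<close> lies in the commutative centraliser of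
  a non-real quaternion.  If that entry is \<open>0\<close>, then \<open>2 \<bar>a\<bar>\<^sup>2\<close> also has mean value \<open>1\<close>, so every \<open>a\<close> is
  real; the same applied to products shows that \<open>b\<close> and \<open>d\<close> lie on one real line for
  any two elements \<open>a + b j\<close> and \<open>c + d j\<close> of \<open>H\<close>, and these commute again.\<close>

lemma finite_subgroup_SU2_commutes:
  assumes H: "subgroup H SU2" and fin: "finite H" and no: "- mat 1 \<notin> H"
    and AB: "A \<in> H" "B \<in> H"
  shows "A ** B = B ** A"
proof (cases "H = {mat 1}")
  case True
  then show ?thesis using AB by simp
next
  case False
  interpret S: group SU2 by (rule group_SU2)
  interpret H: subgroup H SU2 by fact
  define a b where "a X = X $ 1 $ 1" and "b X = X $ 1 $ 2" for X :: cmat2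
  have q: "X = quat (a X) (b X)" and n: "(cmod (a X))\<^sup>2 + (cmod (b X))\<^sup>2 = 1" if "X \<in> H" for X
    using H.mem_carrier[OF that] by (auto simp: a_def b_def elim!: SU2_cases)
  obtain X where "X \<in> H" "X \<noteq> mat 1"
    using False H.one_closed by auto
  have bij: "(\<lambda>X. X ** X) ` H = H"
    using fin inj_on_square[OF H no] H.m_closed by (intro endo_inj_surj) auto
  have "(\<Sum>X\<in>H. a (X ** X)) = (\<Sum>X\<in>H. a X)"
    using sum.reindex[OF inj_on_square[OF H no], of a] bij by simp
  also have "\<dots> = 0"
    unfolding a_def using H \<open>X \<in> H\<close> \<open>X \<noteq> mat 1\<close> by (rule sum_subgroup_entry_eq_0)
  finally have "(\<Sum>X\<in>H. a (X ** X)) = 0" .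
  then have "(\<Sum>X\<in>H. Re (a (X ** X))) = 0"
    by (metis Re_sum zero_complex.simps(1))
  moreover have "Re (a (X ** X)) = 2 * (Re (a X))\<^sup>2 - 1" if "X \<in> H" for X
    by (subst (1 2) q[OF that], subst SU2_square[OF n[OF that]]) (simp add: a_def power2_eq_square)
  ultimately have re: "(\<Sum>X\<in>H. 2 * (Re (a X))\<^sup>2 - 1) = 0"
    by (metis (no_types, lifting) sum.cong)

  \<comment> \<open>\<open>Q\<close> is invariant under conjugation by \<open>H\<close>, and its first entry is \<open>\<i> m\<close>.\<close>
  define Q where "Q = (\<Sum>X\<in>H. X ** (quat \<i> 0 ** conj_transpose X))"
  have conjq: "X ** (quat \<i> 0 ** conj_transpose X)
      = quat (\<i> * ((cmod (a X))\<^sup>2 - (cmod (b X))\<^sup>2)) (- 2 * \<i> * a X * b X)" if "X \<in> H" for X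
    unfolding of_real_diff complex_norm_square
    by (subst (1 2) q[OF that])
      (simp add: conj_transpose_quat quat_mult quat_eq_iff algebra_simps)
  define m m' where "m = (\<Sum>X\<in>H. (cmod (a X))\<^sup>2 - (cmod (b X))\<^sup>2)"
    and "m' = (\<Sum>X\<in>H. - 2 * \<i> * a X * b X)"
  have Q: "Q = quat (\<i> * m) m'"
    unfolding Q_def m_def m'_def of_real_sum sum_distrib_left quat_sum[symmetric]
    using conjq by (intro sum.cong) auto
  have comm: "Q ** A = A ** Q" if "A \<in> H" for A
  proof -
    have cA: "conj_transpose A ** A = mat 1"
      using H.mem_carrier[OF that] by (simp add: SU2_def)
    have "A ** Q ** conj_transpose A = (\<Sum>X\<in>H. (A ** X) ** (quat \<i> 0 ** conj_transpose (A ** X)))"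
      unfolding Q_def matrix_sum_distrib
    proof (rule sum.cong)
      fix X assume "X \<in> H"
      have "conj_transpose (A ** X) = conj_transpose X ** conj_transpose A"
        by (simp add: vec_eq_iff forall_2 conj_transpose_def matrix_matrix_mult_def sum_2
            mult.commute)
      then show "A ** (X ** (quat \<i> 0 ** conj_transpose X)) ** conj_transpose A
          = (A ** X) ** (quat \<i> 0 ** conj_transpose (A ** X))"
        by (simp add: matrix_mul_assoc)
    qed simp
    also have "\<dots> = Q"
      unfolding Q_def by (rule sum_mult_left_subgroup[OF H that])
    finally have "A ** Q ** (conj_transpose A ** A) = Q ** A"
      by (simp add: matrix_mul_assoc)
    then show ?thesis by (simp add: cA)
  qed
  show ?thesis
  proof (cases "m = 0")
    case False
    show ?thesis
      using commute_of_commute_quat[of "\<i> * m" m' "a A" "b A" "a B" "b B"] False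
        comm[OF AB(1)] comm[OF AB(2)] q[OF AB(1)] q[OF AB(2)]
      unfolding Q by simp
  next
    case True
    \<comment> \<open>From \<open>\<bar>a\<bar>\<^sup>2 + \<bar>b\<bar>\<^sup>2 = 1\<close>: twice the sum of the \<open>(Im a)\<^sup>2\<close> is the difference of two sums
      that both vanish.\<close>
    have "(\<Sum>X\<in>H. 2 * (Im (a X))\<^sup>2) = m - (\<Sum>X\<in>H. 2 * (Re (a X))\<^sup>2 - 1)"
      unfolding m_def sum_subtractf[symmetric]
    proof (rule sum.cong)
      fix X assume "X \<in> H"
      show "2 * (Im (a X))\<^sup>2 = (cmod (a X))\<^sup>2 - (cmod (b X))\<^sup>2 - (2 * (Re (a X))\<^sup>2 - 1)"
        using n[OF \<open>X \<in> H\<close>] cmod_power2[of "a X"] by simp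
    qed simp
    then have "(\<Sum>X\<in>H. 2 * (Im (a X))\<^sup>2) = 0" using True re by simp
    then have im: "Im (a X) = 0" if "X \<in> H" for X
      using that fin by (simp add: sum_nonneg_eq_0_iff)
    have cnj: "cnj (a X) = a X" if "X \<in> H" for X
      using im[OF that] by (simp add: complex_eq_iff)
    have AB': "A ** B = quat (a A * a B - b A * cnj (b B)) (a A * b B + b A * cnj (a B))"
      using quat_mult q[OF AB(1)] q[OF AB(2)] by metis
    have BA': "B ** A = quat (a B * a A - b B * cnj (b A)) (a B * b A + b B * cnj (a A))"
      using quat_mult q[OF AB(1)] q[OF AB(2)] by metis
    \<comment> \<open>The first entry of \<open>A B\<close> is real as well.\<close>
    have "A ** B \<in> H" using H.m_closed[of A B] AB by simp
    then have "Im (a A * a B - b A * cnj (b B)) = 0"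
      using im[of "A ** B"] unfolding AB' by (simp add: a_def)
    then have "Im (b A * cnj (b B)) = 0"
      using im AB by simp
    then have "b A * cnj (b B) = b B * cnj (b A)"
      by (simp add: complex_eq_iff algebra_simps)
    then show ?thesis
      unfolding AB' BA' quat_eq_iff using cnj AB by (simp add: algebra_simps)
  qed
qed

section \<open>Abelian simple groups\<close>

text \<open>If the image of a simple group contains \<open>- 1\<close>, then the homomorphism is injective and a
  preimage of \<open>- 1\<close> is a non-trivial central element, so the group equals its centre.  Otherwise
  the image is abelian by the preceding section.  Applied to the three coordinates of \<open>SU(2)\<^sup>3\<close>, this
  makes every finite simple subgroup abelian.\<close>

lemma (in simple_group) hom_SU2_commutes:
  assumes fin: "finite (carrier G)" and f: "f \<in> hom G SU2"
    and xy: "x \<in> carrier G" "y \<in> carrier G"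
  shows "f (x \<otimes> y) = f (y \<otimes> x)"
proof -
  interpret f: group_hom G SU2 f
    by (intro group_hom.intro group_hom_axioms.intro is_group group_SU2 f)
  show ?thesis
  proof (cases "- mat 1 \<in> f ` carrier G")
    case False
    then have "f x ** f y = f y ** f x"
      using fin xy by (intro finite_subgroup_SU2_commutes[OF f.img_is_subgroup]) auto
    then show ?thesis
      using xy by (simp add: f.hom_mult)
  next
    case True
    then obtain z where z: "z \<in> carrier G" and fz: "f z = - mat 1"
      by auto
    have "(- mat 1 :: cmat2) \<noteq> mat 1"
      by (auto simp: vec_eq_iff forall_2 mat_def)
    then have "z \<notin> kernel G SU2 f" and "z \<noteq> \<one>"
      using fz f.hom_one by (auto simp: kernel_def)
    then have "kernel G SU2 f = {\<one>}"
      using no_real_normal_subgroup[OF f.normal_kernel] z by auto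
    then have inj: "inj_on f (carrier G)"
      by (rule f.trivial_ker_imp_inj)
    define Z where "Z = {c \<in> carrier G. \<forall>g \<in> carrier G. c \<otimes> g = g \<otimes> c}"
    have Z: "c \<in> carrier G" "c \<otimes> g = g \<otimes> c" if "c \<in> Z" "g \<in> carrier G" for c g
      using that by (auto simp: Z_def)
    have "subgroup Z G"
    proof (rule subgroupI)
      show "Z \<subseteq> carrier G" by (auto simp: Z_def)
      show "Z \<noteq> {}" using one_closed by (force simp: Z_def)
    next
      fix a assume a: "a \<in> Z"
      have "inv a \<otimes> g = g \<otimes> inv a" if g: "g \<in> carrier G" for g
      proof -
        have "inv a \<otimes> g = inv a \<otimes> (g \<otimes> a) \<otimes> inv a"
          using Z(1)[OF a g] g by (simp add: m_assoc)
        also have "\<dots> = inv a \<otimes> (a \<otimes> g) \<otimes> inv a"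
          by (simp only: Z(2)[OF a g])
        also have "\<dots> = g \<otimes> inv a"
          using Z(1)[OF a g] g by (simp flip: m_assoc)
        finally show ?thesis .
      qed
      then show "inv a \<in> Z" using a unfolding Z_def by blast
    next
      fix a b assume ab: "a \<in> Z" "b \<in> Z"
      have "a \<otimes> b \<otimes> g = g \<otimes> (a \<otimes> b)" if "g \<in> carrier G" for g
        using Z[OF ab(1) that] Z[OF ab(2) that] that by (metis m_assoc)
      then show "a \<otimes> b \<in> Z" using ab unfolding Z_def by blast
    qed
    then have "Z \<lhd> G"
      unfolding normal_inv_iff
    proof (intro conjI ballI)
      fix a h assume a: "a \<in> carrier G" and h: "h \<in> Z"
      have "a \<otimes> h \<otimes> inv a = h"
        unfolding Z(2)[OF h a, symmetric] using a Z(1)[OF h a] by (simp add: m_assoc)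
      then show "a \<otimes> h \<otimes> inv a \<in> Z" using h by simp
    qed
    moreover have "z \<in> Z"
    proof -
      have "z \<otimes> g = g \<otimes> z" if "g \<in> carrier G" for g
      proof (rule inj_onD[OF inj])
        have "(- mat 1) ** A = A ** (- mat 1)" for A :: cmat2
          by (simp add: vec_eq_iff forall_2 matrix_matrix_mult_def sum_2 mat_def)
        then show "f (z \<otimes> g) = f (g \<otimes> z)"
          using that z by (simp add: f.hom_mult fz)
      qed (use that z in auto)
      then show ?thesis using z unfolding Z_def by blast
    qed
    ultimately have "Z = carrier G"
      using no_real_normal_subgroup[of Z] \<open>z \<noteq> \<one>\<close> by auto
    then show ?thesis using Z(2)[of x y] xy by simp
  qed
qed

text \<open>Every non-trivial element generates the whole group, because all subgroups of an abelian
  group are normal.  Hence all non-trivial elements have the same order, also the powers of a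
  generator \<open>g\<close>; but \<open>g [^] d\<close> has order \<open>ord g div d\<close> for a divisor \<open>d\<close> of \<open>ord g\<close>.\<close>

lemma (in simple_group) cyclic_of_prime_order_of_commute:
  assumes comm: "\<And>x y. x \<in> carrier G \<Longrightarrow> y \<in> carrier G \<Longrightarrow> x \<otimes> y = y \<otimes> x"
  obtains g where "g \<in> carrier G" "prime (ord g)" "carrier G = range (\<lambda>n::int. g [^] n)"
proof -
  have gen: "generate G {x} = carrier G" if x: "x \<in> carrier G" "x \<noteq> \<one>" for x
  proof -
    have "subgroup (generate G {x}) G"
      using x by (intro generate_is_subgroup) auto
    then have "generate G {x} \<lhd> G"
      unfolding normal_inv_iff
    proof (intro conjI ballI)
      fix a h assume a: "a \<in> carrier G" and h: "h \<in> generate G {x}"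
      have "h \<in> carrier G"
        using \<open>subgroup (generate G {x}) G\<close> h by (rule subgroup.mem_carrier)
      then have "a \<otimes> h \<otimes> inv a = h"
        using a comm[of a h] by (simp add: m_assoc)
      then show "a \<otimes> h \<otimes> inv a \<in> generate G {x}"
        using h by simp
    qed
    moreover have "x \<in> generate G {x}"
      by (simp add: generate.incl)
    ultimately show ?thesis
      using no_real_normal_subgroup[of "generate G {x}"] x by auto
  qed
  have ord: "ord x = order G" if "x \<in> carrier G" "x \<noteq> \<one>" for x
    using generate_pow_card[of x] gen that by (simp add: order_def)
  obtain g where g: "g \<in> carrier G" "g \<noteq> \<one>"
    using simple_not_triv one_closed by blast
  have "prime (ord g)"
  proof (unfold prime_nat_iff, intro conjI allI impI)
    show "1 < ord g" using order_gt_one ord[OF g] by simp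
    fix d assume d: "d dvd ord g"
    show "d = 1 \<or> d = ord g"
    proof (cases "g [^] d = \<one>")
      case True
      then show ?thesis using d g pow_eq_id dvd_antisym by blast
    next
      case False
      then have "d \<noteq> 0" by (metis nat_pow_0)
      have "ord g div d = ord g"
        using ord_pow[OF g(1) d \<open>d \<noteq> 0\<close>] ord[of "g [^] d"] ord[OF g] g False by simp
      then show ?thesis
        using \<open>1 < ord g\<close> by (simp add: div_eq_dividend_iff)
    qed
  qed
  moreover have "carrier G = range (\<lambda>n::int. g [^] n)"
    using generate_pow[OF g(1)] gen[OF g] by auto
  ultimately show thesis using that g by blast
qed

text \<open>A homomorphism from the integers is the power map of its value at \<open>1\<close>.  This identifies powers
  with explicitly parametrised families.\<close>

lemma (in group) int_hom_eq_pow: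
  fixes F :: "int \<Rightarrow> 'a"
  assumes F: "\<And>n. F n \<in> carrier G" and add: "\<And>m n. F (m + n) = F m \<otimes> F n"
  shows "F n = F 1 [^] n"
proof -
  have pow: "F 1 [^] (i + 1) = F 1 [^] i \<otimes> F 1" for i :: int
    using F[of 1] by (simp add: int_pow_mult)
  show ?thesis
  proof (induction n rule: int_induct[where k = 0])
    case base
    have "F 0 \<otimes> F 0 = F 0" using add[of 0 0] by simp
    then show ?case using F by (metis int_pow_0 r_cancel_one)
  next
    case (step1 i)
    then show ?case using add[of i 1] pow by simp
  next
    case (step2 i)
    have "F (i - 1) \<otimes> F 1 = (F 1 [^] (i - 1)) \<otimes> F 1"
      using step2 add[of "i - 1" 1] pow[of "i - 1"] by simp
    then show ?case using F[of 1] F[of "i - 1"] by simp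
  qed
qed

section \<open>Roots of unity in SU(2)\<close>

text \<open>The exponent is an arbitrary integer, so that \<open>zeta p\<close> is a homomorphism from the integers onto
  \<open>Zp p\<close> with kernel the multiples of \<open>p\<close>.\<close>

definition zeta :: "nat \<Rightarrow> int \<Rightarrow> cmat2" where
  "zeta p k = quat (cis (2 * pi * k / p)) 0"

lemma zeta_in_SU2 [simp]: "zeta p k \<in> carrier SU2"
  by (simp add: zeta_def quat_in_SU2)

lemma zeta_0 [simp]: "zeta p 0 = mat 1"
  by (simp add: zeta_def quat_one)

lemma zeta_add: "zeta p (k + l) = zeta p k ** zeta p l"
  by (simp add: zeta_def quat_mult quat_eq_iff cis_mult add_divide_distrib ring_distribs)

lemma zeta_eq_1_iff:
  assumes "0 < p"
  shows "zeta p k = mat 1 \<longleftrightarrow> int p dvd k"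
proof
  assume "zeta p k = mat 1"
  then have "cis (2 * pi * k / p) = 1"
    by (simp add: zeta_def quat_eq_iff flip: quat_one)
  then have "cos (2 * pi * k / p) = 1"
    by (metis cis.sel(1) one_complex.sel(1))
  then obtain n :: int where "2 * pi * k / p = n * 2 * pi"
    by (auto simp: cos_one_2pi_int)
  then have "real_of_int k = real_of_int (int p * n)"
    using assms by (simp add: field_simps)
  then show "int p dvd k"
    by (metis dvd_triv_left of_int_eq_iff)
next
  assume "int p dvd k"
  then obtain n where n: "k = int p * n" ..
  have "2 * pi * k / p = 2 * pi * n"
    using assms by (simp add: n)
  then show "zeta p k = mat 1"
    by (simp add: zeta_def cis_multiple_2pi quat_one)
qed

lemma zeta_eq_iff:
  assumes "0 < p"
  shows "zeta p k = zeta p l \<longleftrightarrow> int p dvd k - l"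
proof -
  interpret S: group SU2 by (rule group_SU2)
  have "zeta p k = zeta p (k - l) ** zeta p l"
    by (simp flip: zeta_add)
  then have "zeta p k = zeta p l \<longleftrightarrow> zeta p (k - l) = mat 1"
    using S.r_cancel_one[of "zeta p l" "zeta p (k - l)"] by auto
  then show ?thesis
    by (simp add: zeta_eq_1_iff[OF assms])
qed

text \<open>Two complex numbers of modulus \<open>1\<close> have the same real part if and only if they are equal or
  conjugate.\<close>

lemma Re_zeta_eq_iff:
  assumes "0 < p"
  shows "Re (zeta p k $ 1 $ 1) = Re (zeta p l $ 1 $ 1) \<longleftrightarrow> int p dvd k - l \<or> int p dvd k + l"
proof -
  have "Re z = Re w \<longleftrightarrow> z = w \<or> z = cnj w" if "cmod z = 1" "cmod w = 1" for z w
  proof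
    assume eq: "Re z = Re w"
    have "(Re z)\<^sup>2 + (Im z)\<^sup>2 = (Re w)\<^sup>2 + (Im w)\<^sup>2"
      using that by (metis cmod_power2)
    then show "z = w \<or> z = cnj w"
      using eq by (auto simp: complex_eq_iff power2_eq_iff)
  qed auto
  then have "Re (cis x) = Re (cis y) \<longleftrightarrow> cis x = cis y \<or> cis x = cis (- y)" for x y
    by (metis cis_cnj norm_cis)
  from this[of "2 * pi * k / p" "2 * pi * l / p"]
  have "Re (zeta p k $ 1 $ 1) = Re (zeta p l $ 1 $ 1) \<longleftrightarrow>
      zeta p k = zeta p l \<or> zeta p k = zeta p (- l)"
    by (simp add: zeta_def quat_eq_iff)
  then show ?thesis
    by (simp add: zeta_eq_iff[OF assms])
qed

lemma zeta_mod:
  assumes "0 < p" shows "zeta p (k mod int p) = zeta p k"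
  by (simp add: zeta_eq_iff[OF assms] mod_eq_dvd_iff[symmetric])

lemma Zp_eq_range_zeta:
  assumes "0 < p" shows "Zp p = range (zeta p)"
proof -
  have *: "quat (exp (2 * pi * \<i> * x / p)) 0 = zeta p (int x)" for x :: nat
    by (simp add: zeta_def cis_conv_exp mult_ac)
  have "zeta p k \<in> Zp p" for k
    unfolding Zp_def *
    using zeta_mod[OF assms, of k] assms
    by (auto intro!: exI[of _ "nat (k mod int p)"] simp: nat_less_iff)
  moreover have "Zp p \<subseteq> range (zeta p)"
    unfolding Zp_def * by blast
  ultimately show ?thesis by blast
qed

lemma zeta_mult_eq_pow: "zeta p (n * k) = zeta p k [^]\<^bsub>SU2\<^esub> n"
  using group.int_hom_eq_pow[OF group_SU2, of "\<lambda>n. zeta p (n * k)" n]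
  by (simp add: ring_distribs zeta_add)

lemma root_of_unity_SU2:
  assumes "0 < p" and "quat z 0 [^]\<^bsub>SU2\<^esub> p = mat 1"
  obtains k where "quat z 0 = zeta p k"
proof -
  have "quat z 0 [^]\<^bsub>SU2\<^esub> n = quat (z ^ n) 0" for n :: nat
    by (induction n) (simp_all add: quat_mult quat_one mult.commute)
  then have "z ^ p = 1"
    using assms by (simp add: quat_eq_iff flip: quat_one)
  then obtain k :: nat where "z = cis (2 * pi * real k / real p)"
    using Complex.bij_betw_roots_unity[OF assms(1)] by (auto simp: bij_betw_def image_iff set_eq_iff)
  then have "quat z 0 = zeta p (int k)"
    by (simp add: zeta_def)
  then show thesis using that by blast
qed

section \<open>Conjugacy classes in SU(2)\<close>

text \<open>The real part of the first entry is half the trace.\<close>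

lemma Re_entry_conj_SU2:
  assumes "X \<in> carrier SU2" and "A \<in> carrier SU2" and "B \<in> carrier SU2" and eq: "A ** X = X ** B"
  shows "Re (A $ 1 $ 1) = Re (B $ 1 $ 1)"
proof -
  interpret S: group SU2 by (rule group_SU2)
  have tr: "Re (trace C) = 2 * Re (C $ 1 $ 1)" if "C \<in> carrier SU2" for C
    using that by (auto elim!: SU2_cases simp: trace_def sum_2)
  have "A = X ** B ** inv\<^bsub>SU2\<^esub> X"
    using S.inv_solve_right[of A "X ** B" X] S.m_closed[of X B] assms by simp
  then have "trace A = trace (inv\<^bsub>SU2\<^esub> X ** (X ** B))"
    by (metis trace_mul_sym)
  also have "inv\<^bsub>SU2\<^esub> X ** (X ** B) = B"
    using S.l_inv[OF assms(1)] by (simp add: matrix_mul_assoc)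
  finally show ?thesis
    using tr assms by (metis mult_left_cancel zero_neq_numeral)
qed

text \<open>The diagonal matrix is chosen with non-negative imaginary part, so it depends only on the trace
  of \<open>A\<close>.  Hence elements with the same trace are conjugate to one and the same matrix.\<close>

lemma SU2_diagonalise:
  assumes "A \<in> carrier SU2"
  obtains X where "X \<in> carrier SU2"
    "A ** X = X ** quat (Complex (Re (A $ 1 $ 1)) (sqrt (1 - (Re (A $ 1 $ 1))\<^sup>2))) 0"
proof -
  obtain a b where A: "A = quat a b" and n: "(cmod a)\<^sup>2 + (cmod b)\<^sup>2 = 1"
    using assms by (rule SU2_cases)
  define s t where "s = sqrt (1 - (Re a)\<^sup>2)" and "t = Im a"
  have "1 - (Re a)\<^sup>2 = t\<^sup>2 + (cmod b)\<^sup>2"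
    using n cmod_power2[of a] unfolding t_def by simp
  then have s2: "s\<^sup>2 = t\<^sup>2 + (cmod b)\<^sup>2"
    by (simp add: s_def)
  have a: "a = Complex (Re a) t"
    by (simp add: t_def)
  have "\<exists>X \<in> carrier SU2. A ** X = X ** quat (Complex (Re a) s) 0"
  proof (cases "b = 0")
    case True
    then have "t = s \<or> t = - s"
      using s2 by (auto simp: power2_eq_iff)
    then show ?thesis
    proof
      assume "t = s"
      then have "A ** quat 1 0 = quat 1 0 ** quat (Complex (Re a) s) 0"
        using a by (simp add: A True quat_mult)
      then show ?thesis by (rule bexI) (simp add: quat_in_SU2)
    next
      \<comment> \<open>Conjugation by the quaternion \<open>j\<close> is complex conjugation on the diagonal matrices.\<close>
      assume "t = - s"
      then have "A ** quat 0 1 = quat 0 1 ** quat (Complex (Re a) s) 0"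
        using a by (simp add: A True quat_mult quat_eq_iff complex_eq_iff)
      then show ?thesis by (rule bexI) (simp add: quat_in_SU2)
    qed
  next
    case False
    \<comment> \<open>Write \<open>V = \<i> t + b j\<close> for the imaginary part of \<open>A\<close>.  Then \<open>V\<^sup>2 = - s\<^sup>2\<close>, so \<open>X = V + \<i> s\<close>
      satisfies \<open>V X = X (\<i> s)\<close>; it remains to divide by the norm \<open>r\<close> of \<open>X\<close>.\<close>
    define r where "r = sqrt ((t + s)\<^sup>2 + (cmod b)\<^sup>2)"
    have "0 < (t + s)\<^sup>2 + (cmod b)\<^sup>2"
      using False by (intro add_nonneg_pos) auto
    then have "0 < r"
      unfolding r_def by (rule real_sqrt_gt_zero)
    define X where "X = quat (\<i> * of_real ((t + s) / r)) (b / of_real r)"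
    have "r\<^sup>2 = (t + s)\<^sup>2 + (cmod b)\<^sup>2"
      by (simp add: r_def)
    then have "((t + s)\<^sup>2 + (cmod b)\<^sup>2) / r\<^sup>2 = 1"
      using \<open>0 < r\<close> by (metis divide_self less_irrefl power_eq_0_iff)
    moreover have "(cmod (\<i> * of_real ((t + s) / r)))\<^sup>2 = (t + s)\<^sup>2 / r\<^sup>2"
      by (simp only: norm_mult norm_ii norm_of_real power2_abs power_divide mult_1)
    moreover have "(cmod (b / of_real r))\<^sup>2 = (cmod b)\<^sup>2 / r\<^sup>2"
      by (simp only: norm_divide norm_of_real power2_abs power_divide)
    ultimately have "X \<in> carrier SU2"
      by (simp only: X_def quat_in_SU2 add_divide_distrib)
    moreover have "A ** X = X ** quat (Complex (Re a) s) 0"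
    proof -
      have bb: "b * cnj b = of_real (s\<^sup>2 - t\<^sup>2)"
        using s2 by (metis add_diff_cancel_left' complex_norm_square)
      have e1: "a * (\<i> * (t + s)) - b * cnj b = \<i> * (t + s) * Complex (Re a) s"
        unfolding bb by (subst a) (simp add: complex_eq_iff algebra_simps power2_eq_square)
      have e2: "a * b + b * cnj (\<i> * (t + s)) = b * cnj (Complex (Re a) s)"
      proof -
        have "a + cnj (\<i> * (t + s)) = cnj (Complex (Re a) s)"
          by (subst a) (simp add: complex_eq_iff)
        then show ?thesis by (metis distrib_left mult.commute)
      qed
      have "A ** X = quat ((a * (\<i> * (t + s)) - b * cnj b) / r) ((a * b + b * cnj (\<i> * (t + s))) / r)"
        by (simp add: A X_def quat_mult quat_eq_iff add_divide_distrib diff_divide_distrib ring_distribs)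
      also have "\<dots> = X ** quat (Complex (Re a) s) 0"
        unfolding e1 e2 by (simp add: X_def quat_mult quat_eq_iff add_divide_distrib ring_distribs)
      finally show ?thesis .
    qed
    ultimately show ?thesis by blast
  qed
  then show thesis
    using that by (auto simp: A s_def)
qed

lemma finite_order_conj_zeta:
  assumes "A \<in> carrier SU2" and "0 < p" and pow: "A [^]\<^bsub>SU2\<^esub> p = mat 1"
  obtains X k where "X \<in> carrier SU2" "A ** X = X ** zeta p k"
proof -
  interpret S: group SU2 by (rule group_SU2)
  obtain X z where X: "X \<in> carrier SU2" and AX: "A ** X = X ** quat z 0"
    using SU2_diagonalise[OF assms(1)] by metis
  have "quat z 0 = inv\<^bsub>SU2\<^esub> X \<otimes>\<^bsub>SU2\<^esub> (A \<otimes>\<^bsub>SU2\<^esub> X)"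
    unfolding SU2_simps AX using S.l_inv[OF X] by (simp add: matrix_mul_assoc)
  then have q: "quat z 0 \<in> carrier SU2"
    using X assms(1) by (metis S.inv_closed S.m_closed)
  have "A [^]\<^bsub>SU2\<^esub> n ** X = X ** quat z 0 [^]\<^bsub>SU2\<^esub> n" for n :: nat
  proof (induction n)
    case (Suc n)
    have "A [^]\<^bsub>SU2\<^esub> Suc n ** X = A [^]\<^bsub>SU2\<^esub> n ** X ** quat z 0"
      by (simp add: AX flip: matrix_mul_assoc)
    also have "\<dots> = X ** quat z 0 [^]\<^bsub>SU2\<^esub> Suc n"
      by (simp add: Suc.IH matrix_mul_assoc)
    finally show ?case .
  qed simp
  from this[of p] have "X ** quat z 0 [^]\<^bsub>SU2\<^esub> p = X"
    by (simp add: pow)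
  then have "quat z 0 [^]\<^bsub>SU2\<^esub> p = mat 1"
    using S.l_cancel_one[OF X S.nat_pow_closed[OF q]] by simp
  then show thesis
    using root_of_unity_SU2[OF assms(2)] that X AX by metis
qed

section \<open>Fixed points\<close>

lemma G_simps [simp]:
  "(u, v, w) \<in> carrier G \<longleftrightarrow> u \<in> carrier SU2 \<and> v \<in> carrier SU2 \<and> w \<in> carrier SU2"
  "(u, v, w) \<otimes>\<^bsub>G\<^esub> (x, y, z) = (u ** x, v ** y, w ** z)"
  "\<one>\<^bsub>G\<^esub> = (mat 1, mat 1, mat 1)"
  by (simp_all add: G_def)

lemma nat_pow_G: "(u, v, w) [^]\<^bsub>G\<^esub> (n :: nat) = (u [^]\<^bsub>SU2\<^esub> n, v [^]\<^bsub>SU2\<^esub> n, w [^]\<^bsub>SU2\<^esub> n)"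
  by (induction n) simp_all

text \<open>An element \<open>(u, v, w)\<close> fixes the coset of \<open>(x, y, z)\<close> if and only if \<open>x\<close>, \<open>y\<close>, \<open>z\<close> conjugate
  \<open>u\<close>, \<open>v\<close>, \<open>w\<close> to the same element \<open>k\<close>.  Since conjugacy classes in \<open>SU(2)\<close> are determined by the
  trace, there is such a coset exactly when \<open>u\<close>, \<open>v\<close>, \<open>w\<close> have the same trace.\<close>

lemma fixes_point_iff:
  assumes "u \<in> carrier SU2" "v \<in> carrier SU2" "w \<in> carrier SU2"
  shows "(\<exists>m\<in>M. (u, v, w) <#\<^bsub>G\<^esub> m = m) \<longleftrightarrow>
    Re (u $ 1 $ 1) = Re (v $ 1 $ 1) \<and> Re (u $ 1 $ 1) = Re (w $ 1 $ 1)"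
proof -
  interpret S: group SU2 by (rule group_SU2)
  interpret G: group G by (rule group_G)
  interpret K: subgroup K G by (rule subgroup_K)
  show ?thesis
  proof
    assume "\<exists>m\<in>M. (u, v, w) <#\<^bsub>G\<^esub> m = m"
    then obtain g where g: "g \<in> carrier G" and fixd: "(u, v, w) <#\<^bsub>G\<^esub> (g <#\<^bsub>G\<^esub> K) = g <#\<^bsub>G\<^esub> K"
      by (auto simp: M_def LCOSETS_def)
    obtain x y z where xyz: "g = (x, y, z)" by (cases g)
    have "(u, v, w) \<otimes>\<^bsub>G\<^esub> g \<in> g <#\<^bsub>G\<^esub> K"
      using G.lcos_self[OF g subgroup_K] fixd unfolding l_coset_def by blast
    then obtain k where "k \<in> carrier SU2" "u ** x = x ** k" "v ** y = y ** k" "w ** z = z ** k"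
      by (auto simp: xyz l_coset_def K_def)
    then show "Re (u $ 1 $ 1) = Re (v $ 1 $ 1) \<and> Re (u $ 1 $ 1) = Re (w $ 1 $ 1)"
      using Re_entry_conj_SU2[of x u k] Re_entry_conj_SU2[of y v k] Re_entry_conj_SU2[of z w k]
        g assms by (simp add: xyz)
  next
    assume eq: "Re (u $ 1 $ 1) = Re (v $ 1 $ 1) \<and> Re (u $ 1 $ 1) = Re (w $ 1 $ 1)"
    define k where "k = quat (Complex (Re (u $ 1 $ 1)) (sqrt (1 - (Re (u $ 1 $ 1))\<^sup>2))) 0"
    obtain x where x: "x \<in> carrier SU2" "u ** x = x ** k"
      using SU2_diagonalise[OF assms(1)] unfolding k_def by blast
    obtain y where y: "y \<in> carrier SU2" "v ** y = y ** k"
      using SU2_diagonalise[OF assms(2)] eq unfolding k_def by metis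
    obtain z where z: "z \<in> carrier SU2" "w ** z = z ** k"
      using SU2_diagonalise[OF assms(3)] eq unfolding k_def by metis
    have "k = inv\<^bsub>SU2\<^esub> x \<otimes>\<^bsub>SU2\<^esub> (u \<otimes>\<^bsub>SU2\<^esub> x)"
      using x S.l_inv[of x] by (simp add: matrix_mul_assoc)
    then have k: "k \<in> carrier SU2"
      using x assms(1) by (metis S.inv_closed S.m_closed)
    then have kK: "(k, k, k) \<in> K"
      by (auto simp: K_def)
    let ?g = "(x, y, z)"
    have g: "?g \<in> carrier G"
      using x y z by simp
    have "(u, v, w) <#\<^bsub>G\<^esub> (?g <#\<^bsub>G\<^esub> K) = ((u, v, w) \<otimes>\<^bsub>G\<^esub> ?g) <#\<^bsub>G\<^esub> K"
      using assms g by (intro G.lcos_m_assoc K.subset) auto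
    also have "(u, v, w) \<otimes>\<^bsub>G\<^esub> ?g = ?g \<otimes>\<^bsub>G\<^esub> (k, k, k)"
      using x y z by simp
    also have "\<dots> <#\<^bsub>G\<^esub> K = ?g <#\<^bsub>G\<^esub> ((k, k, k) <#\<^bsub>G\<^esub> K)"
      using k g by (intro G.lcos_m_assoc[symmetric] K.subset) auto
    also have "(k, k, k) <#\<^bsub>G\<^esub> K = K"
      using kK by (rule G.coset_join3[OF K.mem_carrier subgroup_K]) (rule kK)
    finally show "\<exists>m\<in>M. (u, v, w) <#\<^bsub>G\<^esub> m = m"
      using g unfolding M_def LCOSETS_def by blast
  qed
qed

lemma acts_freely_iff:
  assumes "C \<subseteq> carrier G"
  shows "acts_freely C \<longleftrightarrow> (\<forall>u v w. (u, v, w) \<in> C \<longrightarrow> (u, v, w) \<noteq> \<one>\<^bsub>G\<^esub> \<longrightarrow>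
    \<not> (Re (u $ 1 $ 1) = Re (v $ 1 $ 1) \<and> Re (u $ 1 $ 1) = Re (w $ 1 $ 1)))"
proof -
  have car: "u \<in> carrier SU2" "v \<in> carrier SU2" "w \<in> carrier SU2" if "(u, v, w) \<in> C" for u v w
    using that assms by auto
  have moves: "(\<forall>m\<in>M. (u, v, w) <#\<^bsub>G\<^esub> m \<noteq> m) \<longleftrightarrow>
      \<not> (Re (u $ 1 $ 1) = Re (v $ 1 $ 1) \<and> Re (u $ 1 $ 1) = Re (w $ 1 $ 1))"
    if "(u, v, w) \<in> C" for u v w
    using fixes_point_iff[OF car[OF that]] by blast
  have "acts_freely C \<longleftrightarrow> (\<forall>u v w. (u, v, w) \<in> C \<longrightarrow> (u, v, w) \<noteq> \<one>\<^bsub>G\<^esub> \<longrightarrow>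
      (\<forall>m\<in>M. (u, v, w) <#\<^bsub>G\<^esub> m \<noteq> m))"
    by (simp only: acts_freely_def Ball_def split_paired_All)
  also have "\<dots> \<longleftrightarrow> (\<forall>u v w. (u, v, w) \<in> C \<longrightarrow> (u, v, w) \<noteq> \<one>\<^bsub>G\<^esub> \<longrightarrow>
      \<not> (Re (u $ 1 $ 1) = Re (v $ 1 $ 1) \<and> Re (u $ 1 $ 1) = Re (w $ 1 $ 1)))"
    by (intro iff_allI imp_cong refl moves)
  finally show ?thesis .
qed

lemma conj_coset_eq_image: "g <#\<^bsub>G\<^esub> C #>\<^bsub>G\<^esub> inv\<^bsub>G\<^esub> g = (\<lambda>c. g \<otimes>\<^bsub>G\<^esub> c \<otimes>\<^bsub>G\<^esub> inv\<^bsub>G\<^esub> g) ` C"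
  by (auto simp: l_coset_def r_coset_def)

lemma inv_G:
  assumes "x \<in> carrier SU2" "y \<in> carrier SU2" "z \<in> carrier SU2"
  shows "inv\<^bsub>G\<^esub> (x, y, z) = (inv\<^bsub>SU2\<^esub> x, inv\<^bsub>SU2\<^esub> y, inv\<^bsub>SU2\<^esub> z)"
  using assms by (simp add: G_def inv_DirProd DirProd_group group_SU2)

text \<open>Equality of the three traces survives conjugation and permutation of the factors, so free
  actions can be tested on the groups in normal form.\<close>

lemma acts_freely_of_equivalent:
  assumes D: "D \<subseteq> carrier G" and eq: "equivalent C D" and free: "acts_freely C"
  shows "acts_freely D"
  unfolding acts_freely_iff[OF D]
proof (intro allI impI notI)
  interpret S: group SU2 by (rule group_SU2)
  interpret G: group G by (rule group_G)
  fix u v w assume d: "(u, v, w) \<in> D" "(u, v, w) \<noteq> \<one>\<^bsub>G\<^esub>"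
    and re: "Re (u $ 1 $ 1) = Re (v $ 1 $ 1) \<and> Re (u $ 1 $ 1) = Re (w $ 1 $ 1)"
  obtain \<pi> g where \<pi>: "\<pi> permutes {0, 1, 2}" and g: "g \<in> carrier G"
    and C: "C = (\<lambda>c. g \<otimes>\<^bsub>G\<^esub> c \<otimes>\<^bsub>G\<^esub> inv\<^bsub>G\<^esub> g) ` permute_factors \<pi> ` D"
    using eq unfolding equivalent_def conj_coset_eq_image by blast
  have uvw: "u \<in> carrier SU2" "v \<in> carrier SU2" "w \<in> carrier SU2"
    using d(1) D by auto
  have "\<pi> ` {0, 1, 2} = {0, 1, 2}"
    using \<pi> by (rule permutes_image)
  then have rng: "{\<pi> 0, \<pi> 1, \<pi> 2} = {0, 1, 2}"
    by simp
  obtain u' v' w' where p: "permute_factors \<pi> (u, v, w) = (u', v', w')"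
    by (cases "permute_factors \<pi> (u, v, w)")
  have fac: "factor (u, v, w) ` {0, 1, 2} = {u, v, w}"
    by (simp add: numeral_2_eq_2)
  have "{u', v', w'} = factor (u, v, w) ` {\<pi> 0, \<pi> 1, \<pi> 2}"
    using p by (auto simp: permute_factors_def)
  then have set: "{u', v', w'} = {u, v, w}"
    unfolding rng fac .
  have uvw': "u' \<in> carrier SU2" "v' \<in> carrier SU2" "w' \<in> carrier SU2"
    using set uvw by (metis insertCI insertE singletonD)+
  have re': "Re (t $ 1 $ 1) = Re (u $ 1 $ 1)" if "t \<in> {u', v', w'}" for t
    using that re unfolding set by auto
  have ne: "(u', v', w') \<noteq> \<one>\<^bsub>G\<^esub>"
    using d(2) set by (auto simp: doubleton_eq_iff)
  obtain x y z where xyz: "g = (x, y, z)" by (cases g)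
  have x: "x \<in> carrier SU2" "y \<in> carrier SU2" "z \<in> carrier SU2"
    using g by (simp_all add: xyz)
  have conj: "h ** t ** inv\<^bsub>SU2\<^esub> h \<in> carrier SU2"
      "Re ((h ** t ** inv\<^bsub>SU2\<^esub> h) $ 1 $ 1) = Re (t $ 1 $ 1)"
    if "h \<in> carrier SU2" "t \<in> carrier SU2" for h t
  proof -
    show car: "h ** t ** inv\<^bsub>SU2\<^esub> h \<in> carrier SU2"
      using that S.m_closed[OF S.m_closed S.inv_closed, of h t h] by simp
    have "(h ** t ** inv\<^bsub>SU2\<^esub> h) ** h = h ** t"
      using S.l_inv[OF that(1)] by (simp flip: matrix_mul_assoc)
    then show "Re ((h ** t ** inv\<^bsub>SU2\<^esub> h) $ 1 $ 1) = Re (t $ 1 $ 1)"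
      using that car by (intro Re_entry_conj_SU2)
  qed
  let ?c = "(x ** u' ** inv\<^bsub>SU2\<^esub> x, y ** v' ** inv\<^bsub>SU2\<^esub> y, z ** w' ** inv\<^bsub>SU2\<^esub> z)"
  have c: "?c = g \<otimes>\<^bsub>G\<^esub> (u', v', w') \<otimes>\<^bsub>G\<^esub> inv\<^bsub>G\<^esub> g"
    using x by (simp add: xyz inv_G)
  have "?c \<in> C"
    unfolding c C p[symmetric] using d(1) by blast
  moreover have "?c \<noteq> \<one>\<^bsub>G\<^esub>"
  proof
    assume "?c = \<one>\<^bsub>G\<^esub>"
    then have "g \<otimes>\<^bsub>G\<^esub> (u', v', w') = g"
      unfolding c using g uvw' G.inv_solve_right'[of "\<one>\<^bsub>G\<^esub>" "g \<otimes>\<^bsub>G\<^esub> (u', v', w')" g]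
      by (metis G.inv_equality G.inv_inv G.inv_closed G.m_closed G_simps(1))
    then show False
      using ne g uvw' G.l_cancel_one[of g "(u', v', w')"] by simp
  qed
  moreover have "C \<subseteq> carrier G"
  proof -
    have "permute_factors \<pi> e \<in> carrier G" if "e \<in> D" for e
    proof -
      obtain a b c where e: "e = (a, b, c)" by (cases e)
      have abc: "{a, b, c} \<subseteq> carrier SU2" using that D by (auto simp: e)
      have "\<forall>i\<in>{\<pi> 0, \<pi> 1, \<pi> 2}. factor e i \<in> carrier SU2"
        unfolding rng using abc by (simp add: e numeral_2_eq_2)
      then show ?thesis by (simp add: permute_factors_def)
    qed
    then show ?thesis unfolding C using g by auto
  qed
  ultimately have "\<not> (Re ((x ** u' ** inv\<^bsub>SU2\<^esub> x) $ 1 $ 1) = Re ((y ** v' ** inv\<^bsub>SU2\<^esub> y) $ 1 $ 1) \<and>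
      Re ((x ** u' ** inv\<^bsub>SU2\<^esub> x) $ 1 $ 1) = Re ((z ** w' ** inv\<^bsub>SU2\<^esub> z) $ 1 $ 1))"
    using free acts_freely_iff by blast
  then show False
    using conj x uvw' re' by simp
qed

section \<open>Cyclic groups of diagonal elements\<close>

definition diag_elt :: "nat \<Rightarrow> int \<Rightarrow> int \<Rightarrow> int \<Rightarrow> cmat2 \<times> cmat2 \<times> cmat2" where
  "diag_elt p k l m = (zeta p k, zeta p l, zeta p m)"

text \<open>All groups in the list have this form with \<open>k = 1\<close>: the first kind has \<open>l = m = 0\<close>, the second
  \<open>m = 0\<close>.  Exponents matter only modulo \<open>p\<close>, and multiplying all of them by a unit modulo \<open>p\<close>
  changes the generator but not the group.\<close>

definition diag_cyclic :: "nat \<Rightarrow> int \<Rightarrow> int \<Rightarrow> int \<Rightarrow> (cmat2 \<times> cmat2 \<times> cmat2) set" where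
  "diag_cyclic p k l m = range (\<lambda>n. diag_elt p (n * k) (n * l) (n * m))"

lemma diag_elt_in_G [simp]: "diag_elt p k l m \<in> carrier G"
  by (simp add: diag_elt_def)

lemma diag_elt_add:
  "diag_elt p (k + k') (l + l') (m + m') = diag_elt p k l m \<otimes>\<^bsub>G\<^esub> diag_elt p k' l' m'"
  by (simp add: diag_elt_def zeta_add)

lemma diag_elt_eq_iff:
  assumes "0 < p"
  shows "diag_elt p k l m = diag_elt p k' l' m' \<longleftrightarrow>
    int p dvd k - k' \<and> int p dvd l - l' \<and> int p dvd m - m'"
  by (simp add: diag_elt_def zeta_eq_iff[OF assms])

lemma diag_elt_eq_one_iff:
  assumes "0 < p"
  shows "diag_elt p k l m = \<one>\<^bsub>G\<^esub> \<longleftrightarrow> int p dvd k \<and> int p dvd l \<and> int p dvd m"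
  by (simp add: diag_elt_def zeta_eq_1_iff[OF assms])

lemma diag_cyclic_cong:
  assumes "0 < p" "int p dvd k - k'" "int p dvd l - l'" "int p dvd m - m'"
  shows "diag_cyclic p k l m = diag_cyclic p k' l' m'"
proof -
  have "diag_elt p (n * k) (n * l) (n * m) = diag_elt p (n * k') (n * l') (n * m')" for n
    using assms by (simp add: diag_elt_eq_iff flip: right_diff_distrib)
  then show ?thesis by (simp add: diag_cyclic_def)
qed

lemma diag_cyclic_scale:
  assumes "0 < p" "coprime c (int p)"
  shows "diag_cyclic p (c * k) (c * l) (c * m) = diag_cyclic p k l m"
proof
  show "diag_cyclic p (c * k) (c * l) (c * m) \<subseteq> diag_cyclic p k l m"
    by (auto simp: diag_cyclic_def simp flip: mult.assoc)
  obtain d where d: "[c * d = 1] (mod int p)"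
    using assms(2) cong_solve_coprime_int by blast
  have "diag_elt p (n * k) (n * l) (n * m)
      = diag_elt p (n * d * (c * k)) (n * d * (c * l)) (n * d * (c * m))" for n
  proof -
    have "int p dvd 1 - c * d"
      using d by (metis cong_iff_dvd_diff cong_sym)
    then have "int p dvd n * i - n * d * (c * i)" for i
      using dvd_mult[of "int p" "1 - c * d" "n * i"] by (simp add: algebra_simps)
    then show ?thesis by (simp add: diag_elt_eq_iff[OF assms(1)])
  qed
  then show "diag_cyclic p k l m \<subseteq> diag_cyclic p (c * k) (c * l) (c * m)"
    unfolding diag_cyclic_def by blast
qed

lemma subgroup_diag_cyclic: "subgroup (diag_cyclic p k l m) G"
proof -
  interpret G: group G by (rule group_G)
  show ?thesis
  proof (rule G.subgroupI)
    show "diag_cyclic p k l m \<subseteq> carrier G" "diag_cyclic p k l m \<noteq> {}"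
      by (auto simp: diag_cyclic_def)
  next
    fix a assume "a \<in> diag_cyclic p k l m"
    then obtain n where a: "a = diag_elt p (n * k) (n * l) (n * m)"
      by (auto simp: diag_cyclic_def)
    have "diag_elt p (- n * k) (- n * l) (- n * m) \<otimes>\<^bsub>G\<^esub> a = \<one>\<^bsub>G\<^esub>"
      unfolding a diag_elt_add[symmetric] by (simp add: diag_elt_def)
    then have "inv\<^bsub>G\<^esub> a = diag_elt p (- n * k) (- n * l) (- n * m)"
      by (intro G.inv_equality) (simp_all add: a)
    then show "inv\<^bsub>G\<^esub> a \<in> diag_cyclic p k l m"
      unfolding diag_cyclic_def by blast
  next
    fix a b assume "a \<in> diag_cyclic p k l m" "b \<in> diag_cyclic p k l m"
    then obtain n n' where "a = diag_elt p (n * k) (n * l) (n * m)"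
      and "b = diag_elt p (n' * k) (n' * l) (n' * m)"
      by (auto simp: diag_cyclic_def)
    then have "a \<otimes>\<^bsub>G\<^esub> b = diag_elt p ((n + n') * k) ((n + n') * l) ((n + n') * m)"
      by (simp add: distrib_right diag_elt_add)
    then show "a \<otimes>\<^bsub>G\<^esub> b \<in> diag_cyclic p k l m"
      unfolding diag_cyclic_def by blast
  qed
qed

lemma card_diag_cyclic:
  assumes "0 < p"
  shows "card (diag_cyclic p 1 r s) = p"
proof -
  let ?f = "\<lambda>n. diag_elt p n (n * r) (n * s)"
  have eq: "?f a = ?f b \<longleftrightarrow> a mod int p = b mod int p" for a b
    using assms by (auto simp: diag_elt_eq_iff mod_eq_dvd_iff simp flip: left_diff_distrib)
  have "diag_cyclic p 1 r s = ?f ` {0..<int p}"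
  proof -
    have "?f n \<in> ?f ` {0..<int p}" for n
      using eq[of n "n mod int p"] assms by (intro image_eqI[of _ _ "n mod int p"]) auto
    then show ?thesis by (auto simp: diag_cyclic_def)
  qed
  moreover have "inj_on ?f {0..<int p}"
    unfolding inj_on_def eq by auto
  ultimately show ?thesis
    by (simp add: card_image)
qed

lemma prime_diag_cyclic_simple:
  assumes "prime p"
  shows "nontrivial_finite_simple_subgroup (diag_cyclic p 1 r s)"
proof -
  let ?C = "diag_cyclic p 1 r s"
  have p: "0 < p" "1 < p" using assms prime_gt_0_nat prime_gt_1_nat by auto
  have card: "card ?C = p" using card_diag_cyclic[OF p(1)] .
  interpret C: group "G\<lparr>carrier := ?C\<rparr>"
    using group.subgroup_imp_group[OF group_G subgroup_diag_cyclic] .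
  have "simple_group (G\<lparr>carrier := ?C\<rparr>)"
    using assms card by (intro C.prime_order_simple) (simp add: order_def)
  moreover have "finite ?C"
    using card p(1) card_ge_0_finite by metis
  moreover have "?C \<noteq> {\<one>\<^bsub>G\<^esub>}"
    using card p(2) by auto
  ultimately show ?thesis
    by (simp add: nontrivial_finite_simple_subgroup_def subgroup_diag_cyclic)
qed

text \<open>By the trace criterion, the \<open>n\<close>-th element fixes a point if and only if \<open>n r\<close> and \<open>n s\<close> are
  both congruent to \<open>n\<close> or \<open>- n\<close>; for \<open>n\<close> prime to \<open>p\<close> this can be divided by \<open>n\<close>.\<close>

lemma acts_freely_diag_cyclic_iff:
  assumes "prime p"
  shows "acts_freely (diag_cyclic p 1 r s) \<longleftrightarrow>
    \<not> ((int p dvd 1 - r \<or> int p dvd 1 + r) \<and> (int p dvd 1 - s \<or> int p dvd 1 + s))"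
proof -
  have p: "0 < p" "\<not> int p dvd 1" "prime (int p)"
    using assms prime_gt_0_nat by (auto simp: zdvd1_eq not_prime_1)
  have pm: "int p dvd n - n * t \<or> int p dvd n + n * t \<longleftrightarrow> int p dvd n \<or> int p dvd 1 - t \<or> int p dvd 1 + t"
    for n t
    using prime_dvd_mult_iff[OF p(3), of n "1 - t"] prime_dvd_mult_iff[OF p(3), of n "1 + t"]
    by (auto simp: algebra_simps)
  have elts: "(\<forall>u v w. (u, v, w) \<in> diag_cyclic p 1 r s \<longrightarrow> Q u v w) \<longleftrightarrow>
      (\<forall>n. Q (zeta p n) (zeta p (n * r)) (zeta p (n * s)))" for Q
    by (auto simp: diag_cyclic_def diag_elt_def)
  have "acts_freely (diag_cyclic p 1 r s) \<longleftrightarrow> (\<forall>n. \<not> int p dvd n \<longrightarrow>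
      \<not> ((int p dvd n - n * r \<or> int p dvd n + n * r) \<and> (int p dvd n - n * s \<or> int p dvd n + n * s)))"
    unfolding acts_freely_iff[OF subgroup.subset[OF subgroup_diag_cyclic]] elts G_simps prod.inject
      Re_zeta_eq_iff[OF p(1)] zeta_eq_1_iff[OF p(1)]
    by (metis dvd_mult2)
  then show ?thesis
    unfolding pm using p(2) by blast
qed

lemma phi_zeta: "phi r (zeta p k) = zeta p (k * r)"
  unfolding phi_def by (subst zeta_mult_eq_pow[symmetric]) (simp add: mult.commute)

lemma listed_groups_eq_diag_cyclic:
  assumes "0 < p"
  shows "group_a p = diag_cyclic p 1 0 0" "group_b p r = diag_cyclic p 1 r 0"
    "group_c p r s = diag_cyclic p 1 r s"
proof -
  show "group_a p = diag_cyclic p 1 0 0"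
    by (auto simp: group_a_def Zp_eq_range_zeta[OF assms] diag_cyclic_def diag_elt_def)
  show "group_b p r = diag_cyclic p 1 r 0"
    unfolding group_b_def graph_phi_def Zp_eq_range_zeta[OF assms] diag_cyclic_def diag_elt_def
    by (auto simp: phi_zeta)
  show "group_c p r s = diag_cyclic p 1 r s"
    unfolding group_c_def Zp_eq_range_zeta[OF assms] diag_cyclic_def diag_elt_def
    by (auto simp: phi_zeta)
qed

text \<open>The three kinds are distinguished by which of \<open>r\<close> and \<open>s\<close> vanish modulo \<open>p\<close>, the case \<open>r = 0\<close>,
  \<open>s \<noteq> 0\<close> being left to permutations of the factors.  In this form the condition on \<open>r\<close> and \<open>s\<close> is
  precisely the one for a free action, for all three kinds: it holds automatically when \<open>s = 0\<close>.\<close>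

lemma listed_groups_eq:
  "listed_groups = {diag_cyclic p 1 r s | p r s. prime p \<and> (int p dvd r \<longrightarrow> int p dvd s) \<and>
    \<not> ((int p dvd 1 - r \<or> int p dvd 1 + r) \<and> (int p dvd 1 - s \<or> int p dvd 1 + s))}"
  (is "_ = ?R")
proof -
  have cong: "[t = 1] (mod int p) \<longleftrightarrow> int p dvd 1 - t" "[t = - 1] (mod int p) \<longleftrightarrow> int p dvd 1 + t"
    for t p
  proof -
    show "[t = 1] (mod int p) \<longleftrightarrow> int p dvd 1 - t"
      unfolding cong_iff_dvd_diff by (rule dvd_diff_commute)
    show "[t = - 1] (mod int p) \<longleftrightarrow> int p dvd 1 + t"
      unfolding cong_iff_dvd_diff by (simp add: add.commute)
  qed
  have cop: "coprime t (int p) \<longleftrightarrow> \<not> int p dvd t" if "prime p" for p t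
    using that by (metis coprime_commute coprime_absorb_left not_prime_unit prime_imp_coprime
        prime_nat_int_transfer)
  have p0: "0 < p" "\<not> int p dvd 1" if "prime p" for p
    using that prime_gt_0_nat by (auto simp: zdvd1_eq not_prime_1)
  show ?thesis
  proof (intro equalityI subsetI)
    fix C assume "C \<in> listed_groups"
    then consider p where "prime p" "C = group_a p"
      | p r where "prime p" "C = group_b p r"
      | p r s where "prime p" "C = group_c p r s" "coprime r (int p)"
          "\<not> ((int p dvd 1 - r \<or> int p dvd 1 + r) \<and> (int p dvd 1 - s \<or> int p dvd 1 + s))"
      unfolding listed_groups_def cong by blast
    then have "\<exists>p r s. C = diag_cyclic p 1 r s \<and> prime p \<and> (int p dvd r \<longrightarrow> int p dvd s) \<and>
      \<not> ((int p dvd 1 - r \<or> int p dvd 1 + r) \<and> (int p dvd 1 - s \<or> int p dvd 1 + s))"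
    proof cases
      case (1 p)
      then show ?thesis
        using p0[OF 1(1)] listed_groups_eq_diag_cyclic(1)[of p]
        by (intro exI[of _ p] exI[of _ 0]) simp
    next
      case (2 p r)
      then show ?thesis
        using p0[OF 2(1)] listed_groups_eq_diag_cyclic(2)[of p r]
        by (intro exI[of _ p] exI[of _ r] exI[of _ 0]) simp
    next
      case (3 p r s)
      then show ?thesis
        using p0[OF 3(1)] cop[OF 3(1)] listed_groups_eq_diag_cyclic(3)[of p r s]
        by (intro exI[of _ p] exI[of _ r] exI[of _ s]) simp
    qed
    then show "C \<in> ?R" by blast
  next
    fix C assume "C \<in> ?R"
    then obtain p r s where C: "C = diag_cyclic p 1 r s" and p: "prime p"
      and rs: "int p dvd r \<longrightarrow> int p dvd s"
      and nc: "\<not> ((int p dvd 1 - r \<or> int p dvd 1 + r) \<and> (int p dvd 1 - s \<or> int p dvd 1 + s))"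
      by blast
    consider "int p dvd r" | "\<not> int p dvd r" "int p dvd s" | "\<not> int p dvd r" "\<not> int p dvd s"
      by blast
    then show "C \<in> listed_groups"
    proof cases
      case 1
      then have "C = group_a p"
        using rs p0[OF p] diag_cyclic_cong[of p 1 1 r 0 s 0]
        by (simp add: C listed_groups_eq_diag_cyclic)
      then show ?thesis using p by (auto simp: listed_groups_def)
    next
      case 2
      then have "C = group_b p r"
        using p0[OF p] diag_cyclic_cong[of p 1 1 r r s 0]
        by (simp add: C listed_groups_eq_diag_cyclic)
      then show ?thesis using p 2 cop by (auto simp: listed_groups_def)
    next
      case 3
      have "C = group_c p r s"
        using p0[OF p] by (simp add: C listed_groups_eq_diag_cyclic)
      then show ?thesis using p 3 nc cop unfolding listed_groups_def cong by blast
    qed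
  qed
qed

text \<open>A permutation moves a non-zero exponent to the front and a zero exponent, if there is one, to
  the end; dividing by the first exponent modulo \<open>p\<close> then makes it \<open>1\<close>.\<close>

lemma diag_cyclic_normal_form:
  assumes p: "prime p" and ne: "\<not> (int p dvd k \<and> int p dvd l \<and> int p dvd m)"
  obtains \<pi> r s where "\<pi> permutes {0, 1, 2}" "int p dvd r \<longrightarrow> int p dvd s"
    "diag_cyclic p k l m = permute_factors \<pi> ` diag_cyclic p 1 r s"
proof -
  have p0: "0 < p" using p prime_gt_0_nat by auto
  have perm: "diag_cyclic p k l m = permute_factors \<pi> ` diag_cyclic p k' l' m'"
    if "permute_factors \<pi> (k', l', m') = (k, l, m)" "\<pi> permutes {0, 1, 2}" for \<pi> k' l' m'
  proof -
    have eq: "factor (zeta p (n * k'), zeta p (n * l'), zeta p (n * m')) i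
        = zeta p (n * factor (k', l', m') i)" if "i \<in> {0, 1, 2}" for i n
      using that by (auto simp: numeral_2_eq_2)
    have "\<pi> 0 \<in> {0, 1, 2}" "\<pi> 1 \<in> {0, 1, 2}" "\<pi> 2 \<in> {0, 1, 2}"
      using permutes_in_image[OF that(2)] by blast+
    then have "permute_factors \<pi> (diag_elt p (n * k') (n * l') (n * m'))
        = diag_elt p (n * k) (n * l) (n * m)" for n
      using that(1) by (simp add: diag_elt_def permute_factors_def eq del: factor.simps)
    then show ?thesis by (simp add: diag_cyclic_def image_image)
  qed
  have "\<exists>\<pi> k' l' m'. \<pi> permutes {0, 1, 2} \<and> permute_factors \<pi> (k', l', m') = (k, l, m) \<and>
      \<not> int p dvd k' \<and> (int p dvd l' \<longrightarrow> int p dvd m')"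
  proof -
    have swap: "Transposition.transpose i j permutes {0, 1, 2::nat}" if "i \<in> {0, 1, 2}" "j \<in> {0, 1, 2}" for i j
      using that by (intro permutes_swap_id) auto
    consider "\<not> int p dvd k" "int p dvd l \<longrightarrow> int p dvd m"
      | "\<not> int p dvd k" "int p dvd l" "\<not> int p dvd m"
      | "int p dvd k" "\<not> int p dvd l" "int p dvd m"
      | "int p dvd k" "\<not> int p dvd m"
      using ne by blast
    then show ?thesis
    proof cases
      case 1
      have "permute_factors id (k, l, m) = (k, l, m)"
        by (simp add: permute_factors_def numeral_2_eq_2)
      then show ?thesis using 1 permutes_id by blast
    next
      case 2
      have "permute_factors (Transposition.transpose 1 2) (k, m, l) = (k, l, m)"
        by (simp add: permute_factors_def numeral_2_eq_2 Transposition.transpose_def)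
      then show ?thesis using 2 swap[of 1 2] by blast
    next
      case 3
      have "permute_factors (Transposition.transpose 0 1) (l, k, m) = (k, l, m)"
        by (simp add: permute_factors_def numeral_2_eq_2 Transposition.transpose_def)
      then show ?thesis using 3 swap[of 0 1] by blast
    next
      case 4
      have "permute_factors (Transposition.transpose 0 2) (m, l, k) = (k, l, m)"
        by (simp add: permute_factors_def numeral_2_eq_2 Transposition.transpose_def)
      then show ?thesis using 4 swap[of 0 2] by blast
    qed
  qed
  then obtain \<pi> k' l' m' where \<pi>: "\<pi> permutes {0, 1, 2}" "permute_factors \<pi> (k', l', m') = (k, l, m)"
    and k': "\<not> int p dvd k'" and l': "int p dvd l' \<longrightarrow> int p dvd m'"
    by blast
  have "coprime k' (int p)"
    using p k' by (metis coprime_commute prime_imp_coprime prime_nat_int_transfer)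
  then obtain c where c: "[k' * c = 1] (mod int p)"
    using cong_solve_coprime_int by blast
  then have "coprime c (int p)"
    by (metis coprime_iff_invertible_int mult.commute)
  then have "diag_cyclic p k' l' m' = diag_cyclic p (c * k') (c * l') (c * m')"
    by (simp add: diag_cyclic_scale[OF p0])
  also have "\<dots> = diag_cyclic p 1 (c * l') (c * m')"
    using c by (intro diag_cyclic_cong[OF p0]) (simp_all add: cong_iff_dvd_diff mult.commute)
  finally have "diag_cyclic p k l m = permute_factors \<pi> ` diag_cyclic p 1 (c * l') (c * m')"
    using perm[OF \<pi>(2,1)] by simp
  moreover have "int p dvd c * l' \<longrightarrow> int p dvd c * m'"
    using l' \<open>coprime c (int p)\<close> by (auto simp: coprime_dvd_mult_right_iff coprime_commute)
  ultimately show thesis using that \<pi>(1) by blast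
qed

section \<open>Finite simple subgroups\<close>

text \<open>Such a subgroup is abelian because its three coordinate projections kill commutators, hence
  cyclic of prime order \<open>p\<close>.  The three coordinates of a generator have order dividing \<open>p\<close>, so each can
  be conjugated to some power of \<open>e\<^bsup>2\<pi>\<i>/p\<^esup>\<close>.\<close>

lemma finite_simple_subgroup_conj_diag_cyclic:
  assumes "nontrivial_finite_simple_subgroup C"
  obtains p k l m h where "prime p" "\<not> (int p dvd k \<and> int p dvd l \<and> int p dvd m)"
    "h \<in> carrier G" "C = h <#\<^bsub>G\<^esub> diag_cyclic p k l m #>\<^bsub>G\<^esub> inv\<^bsub>G\<^esub> h"
proof -
  interpret S: group SU2 by (rule group_SU2)
  interpret G: group G by (rule group_G)
  have C: "subgroup C G" "finite C" and simple: "simple_group (G\<lparr>carrier := C\<rparr>)"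
    using assms by (auto simp: nontrivial_finite_simple_subgroup_def)
  interpret C: simple_group "G\<lparr>carrier := C\<rparr>" by (rule simple)
  have car: "c \<in> carrier G" if "c \<in> C" for c
    using subgroup.mem_carrier[OF C(1) that] .
  have hom: "fst \<in> hom (G\<lparr>carrier := C\<rparr>) SU2" "fst \<circ> snd \<in> hom (G\<lparr>carrier := C\<rparr>) SU2"
      "snd \<circ> snd \<in> hom (G\<lparr>carrier := C\<rparr>) SU2"
    using car by (auto simp: hom_def G_def)
  have comm: "x \<otimes>\<^bsub>G\<lparr>carrier := C\<rparr>\<^esub> y = y \<otimes>\<^bsub>G\<lparr>carrier := C\<rparr>\<^esub> x"
    if "x \<in> carrier (G\<lparr>carrier := C\<rparr>)" "y \<in> carrier (G\<lparr>carrier := C\<rparr>)" for x y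
    using hom[THEN C.hom_SU2_commutes[rotated], of x y] that C(2)
    by (simp add: prod_eq_iff)
  obtain g where "g \<in> carrier (G\<lparr>carrier := C\<rparr>)" and prime: "prime (C.ord g)"
    and "carrier (G\<lparr>carrier := C\<rparr>) = range (\<lambda>n::int. g [^]\<^bsub>G\<lparr>carrier := C\<rparr>\<^esub> n)"
    using C.cyclic_of_prime_order_of_commute[OF comm] by metis
  then have g: "g \<in> C" and ran: "C = range (\<lambda>n::int. g [^]\<^bsub>G\<lparr>carrier := C\<rparr>\<^esub> n)"
    by simp_all
  define p where "p = C.ord g"
  have p0: "0 < p" using prime prime_gt_0_nat by (simp add: p_def)
  have ran: "C = range (\<lambda>n::int. g [^]\<^bsub>G\<^esub> n)"
    using ran G.int_pow_consistent[OF C(1) g] by simp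
  have "g [^]\<^bsub>G\<lparr>carrier := C\<rparr>\<^esub> p = \<one>\<^bsub>G\<^esub>"
    using C.pow_ord_eq_1[of g] g by (simp add: p_def)
  then have gp: "g [^]\<^bsub>G\<^esub> p = \<one>\<^bsub>G\<^esub>"
    by (simp add: nat_pow_def)
  have g1: "g \<noteq> \<one>\<^bsub>G\<^esub>"
    using C.ord_eq_1[of g] g prime by auto
  obtain u v w where uvw: "g = (u, v, w)" by (cases g)
  have "u \<in> carrier SU2" "v \<in> carrier SU2" "w \<in> carrier SU2"
    using car[OF g] by (simp_all add: uvw)
  moreover have "u [^]\<^bsub>SU2\<^esub> p = mat 1" "v [^]\<^bsub>SU2\<^esub> p = mat 1" "w [^]\<^bsub>SU2\<^esub> p = mat 1"
    using gp by (simp_all add: uvw nat_pow_G)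
  ultimately obtain x y z k l m where x: "x \<in> carrier SU2" "u ** x = x ** zeta p k"
    and y: "y \<in> carrier SU2" "v ** y = y ** zeta p l"
    and z: "z \<in> carrier SU2" "w ** z = z ** zeta p m"
    using finite_order_conj_zeta p0 by metis
  define h where "h = (x, y, z)"
  have h: "h \<in> carrier G" using x y z by (simp add: h_def)
  define F where "F n = h \<otimes>\<^bsub>G\<^esub> diag_elt p (n * k) (n * l) (n * m) \<otimes>\<^bsub>G\<^esub> inv\<^bsub>G\<^esub> h" for n
  have "g \<otimes>\<^bsub>G\<^esub> h = h \<otimes>\<^bsub>G\<^esub> diag_elt p k l m"
    using x y z by (simp add: uvw h_def diag_elt_def)
  then have F1: "F 1 = g"
    using h car[OF g] by (simp add: F_def G.inv_solve_right')
  have "F (n + n') = F n \<otimes>\<^bsub>G\<^esub> F n'" for n n'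
  proof -
    define a b where "a = diag_elt p (n * k) (n * l) (n * m)"
      and "b = diag_elt p (n' * k) (n' * l) (n' * m)"
    have ab: "a \<in> carrier G" "b \<in> carrier G" by (simp_all add: a_def b_def)
    have "(h \<otimes>\<^bsub>G\<^esub> a \<otimes>\<^bsub>G\<^esub> inv\<^bsub>G\<^esub> h) \<otimes>\<^bsub>G\<^esub> (h \<otimes>\<^bsub>G\<^esub> b \<otimes>\<^bsub>G\<^esub> inv\<^bsub>G\<^esub> h)
        = h \<otimes>\<^bsub>G\<^esub> a \<otimes>\<^bsub>G\<^esub> (inv\<^bsub>G\<^esub> h \<otimes>\<^bsub>G\<^esub> h) \<otimes>\<^bsub>G\<^esub> (b \<otimes>\<^bsub>G\<^esub> inv\<^bsub>G\<^esub> h)"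
      using h ab by (simp only: G.m_assoc G.m_closed G.inv_closed)
    also have "\<dots> = h \<otimes>\<^bsub>G\<^esub> (a \<otimes>\<^bsub>G\<^esub> b) \<otimes>\<^bsub>G\<^esub> inv\<^bsub>G\<^esub> h"
      using h ab by (simp only: G.m_assoc G.m_closed G.inv_closed G.l_inv G.r_one)
    finally show ?thesis
      unfolding F_def distrib_right diag_elt_add a_def b_def by simp
  qed
  then have "F n = g [^]\<^bsub>G\<^esub> n" for n
    using G.int_hom_eq_pow[of F n] h F1 by (simp add: F_def del: G_simps)
  then have "C = range F"
    using ran by simp
  then have "C = h <#\<^bsub>G\<^esub> diag_cyclic p k l m #>\<^bsub>G\<^esub> inv\<^bsub>G\<^esub> h"
    by (simp add: conj_coset_eq_image diag_cyclic_def image_image F_def)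
  moreover have "\<not> (int p dvd k \<and> int p dvd l \<and> int p dvd m)"
  proof
    assume "int p dvd k \<and> int p dvd l \<and> int p dvd m"
    then have "diag_elt p k l m = \<one>\<^bsub>G\<^esub>"
      using diag_elt_eq_one_iff[OF p0] by blast
    then have "F 1 = \<one>\<^bsub>G\<^esub>"
      using h by (simp add: F_def del: G_simps)
    then show False using F1 g1 by simp
  qed
  ultimately show thesis
    using that prime h unfolding p_def by blast
qed

theorem theorem2p2:
  shows "(\<forall>C\<in>listed_groups. nontrivial_finite_simple_subgroup C \<and> acts_freely C) \<and>
    (\<forall>C. nontrivial_finite_simple_subgroup C \<and> acts_freely C \<longrightarrow>
       (\<exists>D\<in>listed_groups. equivalent C D))"
proof (intro conjI ballI allI impI)
  fix C assume "C \<in> listed_groups"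
  then show "nontrivial_finite_simple_subgroup C" "acts_freely C"
    unfolding listed_groups_eq using prime_diag_cyclic_simple acts_freely_diag_cyclic_iff by blast+
next
  fix C assume C: "nontrivial_finite_simple_subgroup C \<and> acts_freely C"
  then obtain p k l m h where p: "prime p" and klm: "\<not> (int p dvd k \<and> int p dvd l \<and> int p dvd m)"
    and h: "h \<in> carrier G" and conj: "C = h <#\<^bsub>G\<^esub> diag_cyclic p k l m #>\<^bsub>G\<^esub> inv\<^bsub>G\<^esub> h"
    using finite_simple_subgroup_conj_diag_cyclic by metis
  obtain \<pi> r s where \<pi>: "\<pi> permutes {0, 1, 2}" and rs: "int p dvd r \<longrightarrow> int p dvd s"
    and perm: "diag_cyclic p k l m = permute_factors \<pi> ` diag_cyclic p 1 r s"
    using diag_cyclic_normal_form[OF p klm] by metis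
  let ?D = "diag_cyclic p 1 r s"
  have eq: "equivalent C ?D"
    unfolding equivalent_def using \<pi> h conj unfolding perm by blast
  then have "acts_freely ?D"
    using acts_freely_of_equivalent[OF subgroup.subset[OF subgroup_diag_cyclic]] C by blast
  then have "?D \<in> listed_groups"
    unfolding listed_groups_eq acts_freely_diag_cyclic_iff[OF p] using p rs by blast
  then show "\<exists>D\<in>listed_groups. equivalent C D"
    using eq by blast
qed

end
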